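(* Let $\alpha>-1$ and let $n\ge1$ be an integer. Then $$\mathfrak{B}_{n,\alpha}(x)=\frac{-(-i)^n\,\gamma_{n,\alpha}}{2^{1+\alpha/2}(\alpha+1)\Gamma(\alpha+1)^{1/2}}\sum_{j\in\mathbb{Z}\setminus\{0\}}\frac{(-1)^j}{s_j^n}\,e_{\alpha,j}(x),$$ where the series converges in $L^2([-1,1],d\mu_\alpha)$.
   Context: For real $\alpha>-1$ let $\mathcal{I}_\alpha$ be the entire function $$\mathcal{I}_\alpha(z)=2^\alpha\Gamma(\alpha+1)\frac{J_\alpha(iz)}{(iz)^\alpha}=\Gamma(\alpha+1)\sum_{n=0}^\infty\frac{(z/2)^{2n}}{n!\,\Gamma(n+\alpha+1)},$$ where $J_\alpha$ is the Bessel function of order $\alpha$, and let $E_\alpha(z)=\mathcal{I}_\alpha(z)+\frac{z}{2(\alpha+1)}\mathcal{I}_{\alpha+1}(z)$. Write $(a)_n=a(a+1)\cdots(a+n-1)$ (with $(a)_0=1$) and $$\gamma_{2k,\alpha}=2^{2k}k!\,(\alpha+1)_k,\qquad \gamma_{2k+1,\alpha}=2^{2k+1}k!\,(\alpha+1)_{k+1},$$ so that $E_\alpha(z)=\sum_{n\ge0} z^n/\gamma_{n,\alpha}$. The Bernoulli-Dunkl polynomials $\mathfrak{B}_{n,\alpha}$, $n\ge0$, are defined by the generating function (for $t$ near $0$) $$\frac{E_\alpha(xt)}{\mathcal{I}_{\alpha+1}(t)}=\sum_{n=0}^\infty\frac{\mathfrak{B}_{n,\alpha}(x)}{\gamma_{n,\alpha}}\,t^n.$$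 Let $s_1<s_2<\cdots$ be the positive zeros of $J_{\alpha+1}$, and put $s_{-j}=-s_j$, $s_0=0$. Let $d\mu_\alpha(x)=\frac{|x|^{2\alpha+1}}{2^{\alpha+1}\Gamma(\alpha+1)}\,dx$. The Fourier-Dunkl system is $$e_{\alpha,j}(r)=\frac{2^{\alpha/2}\Gamma(\alpha+1)^{1/2}}{|\mathcal{I}_\alpha(is_j)|}E_\alpha(is_jr)\quad(j\in\mathbb{Z}\setminus\{0\}),\qquad e_{\alpha,0}(r)=2^{(\alpha+1)/2}\Gamma(\alpha+2)^{1/2},$$ for $r\in(-1,1)$. It is a known theorem that $\{e_{\alpha,j}\}_{j\in\mathbb{Z}}$ is a complete orthonormal system in $L^2((-1,1),d\mu_\alpha)$. *)

theory Defs
  imports "HOL-Complex_Analysis.Complex_Analysis"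
begin

text \<open>
  Bessel function of the first kind of real order, on the principal branch of the power.
  Since \<^term>\<open>Gamma\<close> vanishes at its poles and division by zero gives zero, the terms with
  \<^term>\<open>real n + \<alpha> + 1\<close> a non-positive integer drop out, as they should.
\<close>

definition bessel_J :: "real \<Rightarrow> complex \<Rightarrow> complex" where
  "bessel_J \<alpha> z =
     (z / 2) powr of_real \<alpha> *
     (\<Sum>n. (-1) ^ n * (z / 2) ^ (2 * n) / (fact n * of_real (Gamma (real n + \<alpha> + 1))))"

text \<open>
  The entire function \<open>\<I>\<^sub>\<alpha>\<close>, given by its power series; the lemma \<open>bessel_I_norm_eq_bessel_J\<close>
  below gives the expression through \<^const>\<open>bessel_J\<close>, valid away from the origin.
\<close>

definition bessel_I_norm :: "real \<Rightarrow> complex \<Rightarrow> complex" where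
  "bessel_I_norm \<alpha> z =
     of_real (Gamma (\<alpha> + 1)) *
     (\<Sum>n. (z / 2) ^ (2 * n) / (fact n * of_real (Gamma (real n + \<alpha> + 1))))"

definition dunkl_E :: "real \<Rightarrow> complex \<Rightarrow> complex" where
  "dunkl_E \<alpha> z = bessel_I_norm \<alpha> z + z / (2 * (of_real \<alpha> + 1)) * bessel_I_norm (\<alpha> + 1) z"

definition dunkl_gamma :: "nat \<Rightarrow> real \<Rightarrow> real" where
  "dunkl_gamma n \<alpha> =
     (if even n then 2 ^ n * fact (n div 2) * pochhammer (\<alpha> + 1) (n div 2)
      else 2 ^ n * fact (n div 2) * pochhammer (\<alpha> + 1) (n div 2 + 1))"

text \<open>
  The Bernoulli--Dunkl polynomials, read off from the Taylor expansion at \<open>t = 0\<close> of their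
  generating function; see the lemma \<open>bernoulli_dunkl_generating_function\<close> below.
\<close>

definition bernoulli_dunkl :: "nat \<Rightarrow> real \<Rightarrow> complex \<Rightarrow> complex" where
  "bernoulli_dunkl n \<alpha> x =
     of_real (dunkl_gamma n \<alpha>) *
     fps_nth (fps_expansion (\<lambda>t. dunkl_E \<alpha> (x * t) / bessel_I_norm (\<alpha> + 1) t) 0) n"

text \<open>
  The sequence \<open>s\<close> lists the positive zeros of \<open>J\<^bsub>\<alpha>+1\<^esub>\<close> in increasing order as
  \<open>s 1 < s 2 < \<dots>\<close> and is extended to an odd function on the integers.
\<close>

definition is_bessel_zeros :: "real \<Rightarrow> (int \<Rightarrow> real) \<Rightarrow> bool" where
  "is_bessel_zeros \<alpha> s \<longleftrightarrow>
     strict_mono_on {1..} s \<and>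
     s ` {1..} = {x. x > 0 \<and> bessel_J (\<alpha> + 1) (of_real x) = 0} \<and>
     (\<forall>j. s (- j) = - s j) \<and>
     s 0 = 0"

definition fourier_dunkl :: "real \<Rightarrow> (int \<Rightarrow> real) \<Rightarrow> int \<Rightarrow> real \<Rightarrow> complex" where
  "fourier_dunkl \<alpha> s j r =
     (if j = 0 then of_real (2 powr ((\<alpha> + 1) / 2) * sqrt (Gamma (\<alpha> + 2)))
      else of_real (2 powr (\<alpha> / 2) * sqrt (Gamma (\<alpha> + 1)) / cmod (bessel_I_norm \<alpha> (\<i> * of_real (s j))))
           * dunkl_E \<alpha> (\<i> * of_real (s j) * of_real r))"

definition dunkl_measure :: "real \<Rightarrow> real measure" where
  "dunkl_measure \<alpha> =
     density (restrict_space lborel {-1..1})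
       (\<lambda>x. ennreal (\<bar>x\<bar> powr (2 * \<alpha> + 1) / (2 powr (\<alpha> + 1) * Gamma (\<alpha> + 1))))"

definition square_integrable :: "'a measure \<Rightarrow> ('a \<Rightarrow> complex) \<Rightarrow> bool" where
  "square_integrable M f \<longleftrightarrow> f \<in> borel_measurable M \<and> integrable M (\<lambda>x. (cmod (f x))\<^sup>2)"

definition norm_L2 :: "'a measure \<Rightarrow> ('a \<Rightarrow> complex) \<Rightarrow> real" where
  "norm_L2 M f = sqrt (\<integral>x. (cmod (f x))\<^sup>2 \<partial>M)"

text \<open>
  Unordered convergence in \<open>L\<^sup>2(M)\<close> of the family \<open>f j\<close>, \<open>j \<in> A\<close>, to \<open>g\<close>: the analogue of
  \<^const>\<open>has_sum\<close>, which needs a topology on a type. It entails convergence of the partial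
  sums along every exhaustion of \<open>A\<close> by finite sets, e.g. of the symmetric ones.
\<close>

definition has_sum_L2 :: "'a measure \<Rightarrow> ('i \<Rightarrow> 'a \<Rightarrow> complex) \<Rightarrow> ('a \<Rightarrow> complex) \<Rightarrow> 'i set \<Rightarrow> bool" where
  "has_sum_L2 M f g A \<longleftrightarrow>
     (\<forall>j\<in>A. square_integrable M (f j)) \<and> square_integrable M g \<and>
     ((\<lambda>F. norm_L2 M (\<lambda>x. (\<Sum>j\<in>F. f j x) - g x)) \<longlongrightarrow> 0) (finite_subsets_at_top A)"


lemma bessel_I_norm_eq_bessel_J:
  assumes "z \<noteq> 0"
  shows "bessel_I_norm \<alpha> z =
    of_real (2 powr \<alpha> * Gamma (\<alpha> + 1)) * (bessel_J \<alpha> (\<i> * z) / (\<i> * z) powr of_real \<alpha>)"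
proof -
  have 1: "(\<i> * z / 2) powr of_real \<alpha> = (\<i> * z) powr of_real \<alpha> / of_real (2 powr \<alpha>)"
  proof -
    have "(\<i> * z / 2) powr of_real \<alpha> = (of_real (1/2) * (\<i> * z)) powr of_real \<alpha>"
      by (simp add: field_simps)
    also have "\<dots> = of_real (1/2) powr of_real \<alpha> * (\<i> * z) powr of_real \<alpha>"
      by (rule powr_times_real_left) auto
    also have "of_real (1/2) powr of_real \<alpha> = complex_of_real ((1/2) powr \<alpha>)"
      by (rule powr_of_real) auto
    also have "(1/2) powr \<alpha> = 1 / 2 powr \<alpha>"
      by (simp add: powr_divide)
    finally show ?thesis by simp
  qed
  have 2: "(-1) ^ n * (\<i> * z / 2) ^ (2 * n) = (z / 2) ^ (2 * n)" for n
  proof -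
    have "(-1) ^ n * (\<i> * z / 2) ^ (2 * n) = (-1 * (\<i> * z / 2)\<^sup>2) ^ n"
      by (simp only: power_mult_distrib power_mult)
    also have "-1 * (\<i> * z / 2)\<^sup>2 = (z / 2)\<^sup>2"
      by (simp add: power_mult_distrib power_divide)
    finally show ?thesis by (simp add: power_mult)
  qed
  have "(\<i> * z) powr of_real \<alpha> \<noteq> 0" using assms by simp
  moreover have "(2::real) powr \<alpha> \<noteq> 0" by simp
  ultimately show ?thesis
    unfolding bessel_J_def bessel_I_norm_def 1 2 by (simp add: field_simps)
qed

lemma sums_even_reindex:
  fixes f :: "nat \<Rightarrow> complex"
  assumes "\<And>n. odd n \<Longrightarrow> f n = 0"
  shows "(\<lambda>n. f (2 * n)) sums c \<longleftrightarrow> f sums c"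
proof (rule sums_mono_reindex)
  show "strict_mono (\<lambda>n::nat. 2 * n)" by (rule strict_monoI) simp
  show "f n = 0" if "n \<notin> range (\<lambda>n. 2 * n)" for n
    using that assms[of n] by blast
qed

lemma sums_odd_reindex:
  fixes f :: "nat \<Rightarrow> complex"
  assumes "\<And>n. even n \<Longrightarrow> f n = 0"
  shows "(\<lambda>n. f (2 * n + 1)) sums c \<longleftrightarrow> f sums c"
proof (rule sums_mono_reindex)
  show "strict_mono (\<lambda>n::nat. 2 * n + 1)" by (rule strict_monoI) simp
  show "f n = 0" if "n \<notin> range (\<lambda>n. 2 * n + 1)" for n
  proof (cases "even n")
    case False
    then obtain k where "n = 2 * k + 1" by (rule oddE)
    with that show ?thesis by blast
  qed (use assms in auto)
qed

lemma bessel_I_norm_sums: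
  assumes "\<alpha> > -1"
  shows "(\<lambda>n. z ^ (2 * n) / of_real (dunkl_gamma (2 * n) \<alpha>)) sums bessel_I_norm \<alpha> z"
proof -
  define c where "c n = complex_of_real (1 / dunkl_gamma (2 * n) \<alpha>)" for n
  have poch: "pochhammer (\<alpha> + 1) n > 0" for n
    using assms by (intro pochhammer_pos) auto
  have c: "c n = of_real (1 / (4 ^ n * fact n * pochhammer (\<alpha> + 1) n))" for n
    by (simp add: c_def dunkl_gamma_def power_mult)
  have c0: "c n \<noteq> 0" for n
    using poch[of n] by (simp add: c)
  have "norm (c (Suc n)) / norm (c n) = 1 / (4 * (real n + 1) * (\<alpha> + 1 + real n))" for n
    using poch[of n] assms
    by (simp add: c pochhammer_Suc norm_divide norm_mult norm_power divide_simps add_nonneg_eq_0_iff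
          del: of_real_mult of_real_divide of_real_power of_real_add of_real_fact)
  hence eq: "norm (c n) / norm (c (Suc n)) = 4 * (real n + 1) * (\<alpha> + 1 + real n)" for n
    by (metis div_by_1 divide_divide_eq_right inverse_divide inverse_eq_divide mult_1)
  have "filterlim (\<lambda>n. 4 * (real n + 1) * (\<alpha> + 1 + real n)) at_top sequentially"
    by real_asymp
  hence "(\<lambda>n. ereal (norm (c n) / norm (c (Suc n)))) \<longlonglongrightarrow> \<infinity>"
    unfolding eq tendsto_PInfty_eq_at_top by simp
  hence "conv_radius c = \<infinity>"
    by (intro conv_radius_ratio_limit_ereal_nonzero) auto
  hence "summable (\<lambda>n. c n * (z\<^sup>2) ^ n)"
    by (intro summable_in_conv_radius) auto
  moreover have "(\<lambda>n. c n * (z\<^sup>2) ^ n) = (\<lambda>n. z ^ (2 * n) / of_real (dunkl_gamma (2 * n) \<alpha>))"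
    unfolding c_def power_mult by simp
  ultimately have sm: "summable (\<lambda>n. z ^ (2 * n) / of_real (dunkl_gamma (2 * n) \<alpha>))"
    by simp
  have G: "Gamma (\<alpha> + 1) > 0" using assms by simp
  have G': "Gamma (real n + \<alpha> + 1) = pochhammer (\<alpha> + 1) n * Gamma (\<alpha> + 1)" for n
  proof -
    have "\<alpha> + 1 \<notin> \<int>\<^sub>\<le>\<^sub>0"
      using assms by (auto elim!: nonpos_Ints_cases)
    hence "pochhammer (\<alpha> + 1) n = Gamma (\<alpha> + 1 + real n) / Gamma (\<alpha> + 1)"
      by (rule pochhammer_Gamma)
    moreover have "\<alpha> + 1 + real n = real n + \<alpha> + 1" by simp
    ultimately show ?thesis using G by (metis less_irrefl nonzero_eq_divide_eq)
  qed
  have t: "(z / 2) ^ (2 * n) / (fact n * of_real (Gamma (real n + \<alpha> + 1))) =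
             z ^ (2 * n) / of_real (dunkl_gamma (2 * n) \<alpha>) / of_real (Gamma (\<alpha> + 1))" for n
    by (simp add: G' dunkl_gamma_def power_divide)
  have "bessel_I_norm \<alpha> z = (\<Sum>n. z ^ (2 * n) / of_real (dunkl_gamma (2 * n) \<alpha>))"
    using G unfolding bessel_I_norm_def t by (subst suminf_divide[OF sm]) auto
  thus ?thesis using sm by (simp add: summable_sums)
qed

lemma dunkl_E_sums:
  assumes "\<alpha> > -1"
  shows "(\<lambda>n. z ^ n / of_real (dunkl_gamma n \<alpha>)) sums dunkl_E \<alpha> z"
proof -
  let ?f = "\<lambda>n. z ^ n / of_real (dunkl_gamma n \<alpha>)"
  have odd: "dunkl_gamma (2 * n + 1) \<alpha> = 2 * (\<alpha> + 1) * dunkl_gamma (2 * n) (\<alpha> + 1)" for n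
    using pochhammer_rec[of "\<alpha> + 1" n] by (simp add: dunkl_gamma_def add_ac)
  have "(\<lambda>n. if even n then ?f n else 0) sums bessel_I_norm \<alpha> z"
    using bessel_I_norm_sums[OF assms, of z] by (subst sums_even_reindex [symmetric]) simp_all
  moreover have "(\<lambda>n. if odd n then ?f n else 0) sums
      (z / (2 * (of_real \<alpha> + 1)) * bessel_I_norm (\<alpha> + 1) z)"
  proof (subst sums_odd_reindex [symmetric])
    have "(\<lambda>n. z / (2 * (of_real \<alpha> + 1)) * (z ^ (2 * n) / of_real (dunkl_gamma (2 * n) (\<alpha> + 1))))
            sums (z / (2 * (of_real \<alpha> + 1)) * bessel_I_norm (\<alpha> + 1) z)"
      using assms by (intro sums_mult bessel_I_norm_sums) auto
    moreover have "(\<lambda>n. z / (2 * (of_real \<alpha> + 1)) * (z ^ (2 * n) / of_real (dunkl_gamma (2 * n) (\<alpha> + 1))))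
       = (\<lambda>n. if odd (2 * n + 1) then ?f (2 * n + 1) else 0)"
      unfolding odd by (auto simp: fun_eq_iff)
    ultimately show "(\<lambda>n. if odd (2 * n + 1) then ?f (2 * n + 1) else 0)
            sums (z / (2 * (of_real \<alpha> + 1)) * bessel_I_norm (\<alpha> + 1) z)" by simp
  qed simp
  ultimately have "(\<lambda>n. (if even n then ?f n else 0) + (if odd n then ?f n else 0)) sums dunkl_E \<alpha> z"
    unfolding dunkl_E_def by (rule sums_add)
  also have "(\<lambda>n. (if even n then ?f n else 0) + (if odd n then ?f n else 0)) = ?f"
    by auto
  finally show ?thesis .
qed

lemma bessel_I_norm_0:
  assumes "\<alpha> > -1"
  shows "bessel_I_norm \<alpha> 0 = 1"
proof -
  have "(\<lambda>n. 0 ^ (2 * n) / complex_of_real (dunkl_gamma (2 * n) \<alpha>)) sums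
          (\<Sum>n\<in>{0}. 0 ^ (2 * n) / complex_of_real (dunkl_gamma (2 * n) \<alpha>))"
    by (intro sums_finite) auto
  thus ?thesis
    using sums_unique2[OF bessel_I_norm_sums[OF assms, of 0]] by (simp add: dunkl_gamma_def)
qed

lemma bessel_I_norm_holomorphic:
  assumes "\<alpha> > -1"
  shows "bessel_I_norm \<alpha> holomorphic_on A"
proof -
  define c where "c n = (if even n then 1 / complex_of_real (dunkl_gamma n \<alpha>) else 0)" for n
  have "(\<lambda>n. c n * (z - 0) ^ n) sums bessel_I_norm \<alpha> z" for z
    using bessel_I_norm_sums[OF assms, of z]
    by (subst sums_even_reindex [symmetric]) (simp_all add: c_def)
  hence "bessel_I_norm \<alpha> holomorphic_on ball 0 r" for r
    by (intro power_series_holomorphic[of _ _ c]) auto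
  hence "bessel_I_norm \<alpha> field_differentiable at z" for z
    using holomorphic_on_imp_differentiable_at[of "bessel_I_norm \<alpha>" "ball 0 (norm z + 1)" z]
    by auto
  thus ?thesis
    by (auto simp: holomorphic_on_def intro: field_differentiable_at_within)
qed

lemma bernoulli_dunkl_generating_function:
  assumes "\<alpha> > -1"
  shows "eventually (\<lambda>t. (\<lambda>n. bernoulli_dunkl n \<alpha> x / of_real (dunkl_gamma n \<alpha>) * t ^ n) sums
           (dunkl_E \<alpha> (x * t) / bessel_I_norm (\<alpha> + 1) t)) (nhds 0)"
proof -
  define f where "f = (\<lambda>t. dunkl_E \<alpha> (x * t) / bessel_I_norm (\<alpha> + 1) t)"
  have an: "bessel_I_norm \<beta> analytic_on {z}" if "\<beta> > -1" for \<beta> z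
    using bessel_I_norm_holomorphic[OF that, of UNIV] by (simp add: holomorphic_on_imp_analytic_at)
  have an': "(\<lambda>t. bessel_I_norm \<beta> (x * t)) analytic_on {0}" if "\<beta> > -1" for \<beta>
    using analytic_on_compose[of "\<lambda>t. x * t" "{0}" "bessel_I_norm \<beta>"] an[OF that, of 0]
    by (auto simp: o_def intro!: analytic_intros)
  have "complex_of_real (2 * \<alpha> + 2) \<noteq> 0"
    using assms by (subst of_real_eq_0_iff) auto
  hence ne: "2 * (complex_of_real \<alpha> + 1) \<noteq> 0"
    by (simp add: algebra_simps)
  have "bessel_I_norm (\<alpha> + 1) 0 \<noteq> 0"
    using assms bessel_I_norm_0[of "\<alpha> + 1"] by simp
  with assms ne have "f analytic_on {0}"
    unfolding f_def dunkl_E_def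
    by (intro analytic_intros an an') (simp_all only: singleton_iff, simp_all)
  hence exp: "f has_fps_expansion fps_expansion f 0"
    by (rule analytic_at_imp_has_fps_expansion_0)
  have gam: "dunkl_gamma n \<alpha> \<noteq> 0" for n
  proof -
    have "pochhammer (\<alpha> + 1) k \<noteq> 0" for k
      using pochhammer_pos[of "\<alpha> + 1" k] assms by simp
    thus ?thesis unfolding dunkl_gamma_def by simp
  qed
  have b: "bernoulli_dunkl n \<alpha> x / of_real (dunkl_gamma n \<alpha>) = fps_nth (fps_expansion f 0) n" for n
    using gam[of n] by (simp add: bernoulli_dunkl_def f_def)
  have "eventually (\<lambda>t. t \<in> eball 0 (fps_conv_radius (fps_expansion f 0))) (nhds 0)"
    using exp by (intro eventually_nhds_in_open) (auto simp: has_fps_expansion_def zero_ereal_def)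
  moreover have "eventually (\<lambda>t. eval_fps (fps_expansion f 0) t = f t) (nhds 0)"
    using exp by (simp add: has_fps_expansion_def)
  ultimately have "eventually (\<lambda>t. (\<lambda>n. fps_nth (fps_expansion f 0) n * t ^ n) sums f t) (nhds 0)"
  proof eventually_elim
    case (elim t)
    thus ?case using sums_eval_fps[of t "fps_expansion f 0"] by (auto simp: in_eball_iff)
  qed
  thus ?thesis by (simp add: b f_def)
qed

end

theory Submission
  imports Defs
begin

text \<open>
  Put \<open>t\<^sub>j = \<i> s\<^sub>j\<close> and \<open>u\<^sub>n = B\<^sub>n / \<gamma>\<^sub>n\<close>. For a finite set \<open>F\<close> of nonzero indices let
  \<open>r\<^sub>n\<close> be \<open>u\<^sub>n\<close> minus the part of the claimed expansion with index in \<open>F\<close>. The Dunkl operator \<open>\<Lambda>\<close>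
  is antisymmetric on functions with equal values at \<open>\<plusminus>1\<close>, and \<open>\<Lambda> r\<^bsub>n+1\<^esub> = r\<^sub>n\<close>.
  Completeness of the Fourier--Dunkl system is not needed.

  If \<open>F = {\<plusminus>1, \<dots>, \<plusminus>N}\<close> and \<open>s\<^sub>N < \<rho> < s\<^bsub>N+1\<^esub>\<close>, the residue theorem represents \<open>r\<^sub>n\<close> by the integral
  of \<open>E\<^sub>\<alpha>(x t) / (\<I>\<^bsub>\<alpha>+1\<^esub>(t) t\<^bsup>n+1\<^esup>)\<close> over the circle of radius \<open>\<rho>\<close>, so \<open>\<parallel>r\<^sub>n\<parallel> \<le> K \<rho>\<^bsup>-n\<^esup>\<close>.
  With antisymmetry this decay makes \<open>r\<^sub>n\<close> orthogonal to every eigenfunction with index in \<open>F\<close>;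
  hence \<open>\<parallel>r\<^sub>n\<parallel>\<close> decreases as \<open>F\<close> grows. Antisymmetry also gives the log-convexity
  \<open>\<parallel>r\<^bsub>n+1\<^esub>\<parallel>\<^sup>2 \<le> \<parallel>r\<^sub>n\<parallel> \<parallel>r\<^bsub>n+2\<^esub>\<parallel>\<close> for \<open>n \<ge> 1\<close>, so that the geometric decay rate already holds at each step:
  \<open>\<parallel>r\<^bsub>n+1\<^esub>\<parallel> \<le> \<parallel>r\<^sub>n\<parallel> / \<rho> \<le> \<parallel>u\<^sub>n\<parallel> / s\<^sub>N\<close>, which tends to \<open>0\<close>. Finally \<open>u\<^sub>1\<close> differs from a
  combination of \<open>u\<^sub>3, u\<^sub>5, \<dots>\<close> by a multiple of \<open>x\<^bsup>2l+1\<^esup>\<close>, whose norm tends to \<open>0\<close> as \<open>l \<rightarrow> \<infinity>\<close>.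
\<close>

section \<open>The Dunkl measure\<close>

definition dunkl_weight :: "real \<Rightarrow> real \<Rightarrow> real" where
  "dunkl_weight \<alpha> x = \<bar>x\<bar> powr (2 * \<alpha> + 1) / (2 powr (\<alpha> + 1) * Gamma (\<alpha> + 1))"

lemma dunkl_measure_eq:
  "dunkl_measure \<alpha> = density (restrict_space lborel {-1..1}) (\<lambda>x. ennreal (dunkl_weight \<alpha> x))"
  by (simp add: dunkl_measure_def dunkl_weight_def)

lemma borel_measurable_dunkl_weight [measurable]: "dunkl_weight \<alpha> \<in> borel_measurable borel"
  unfolding dunkl_weight_def by measurable

lemma space_dunkl_measure [simp]: "space (dunkl_measure \<alpha>) = {-1..1}"
  by (simp add: dunkl_measure_def space_restrict_space)

lemma sets_dunkl_measure [measurable_cong]: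
  "sets (dunkl_measure \<alpha>) = sets (restrict_space borel {-1..1})"
  by (simp add: dunkl_measure_def sets_restrict_space)

lemma borel_measurable_dunkl_measure:
  fixes f :: "real \<Rightarrow> 'b::{banach, second_countable_topology}"
  assumes "continuous_on {-1..1} f"
  shows "f \<in> borel_measurable (dunkl_measure \<alpha>)"
proof -
  have "f \<in> borel_measurable (restrict_space borel {-1..1})"
    using assms by (rule borel_measurable_continuous_on_restrict)
  then show ?thesis
    by (subst measurable_cong_sets[OF sets_dunkl_measure refl])
qed

lemma lborel_integrable_abs_powr:
  assumes "a > -1"
  shows "integrable lborel (\<lambda>x::real. indicator {-1..1} x * \<bar>x\<bar> powr a)"
proof -
  have "set_integrable lebesgue {0..1} (\<lambda>x::real. x powr a)"
    using assms integrable_on_powr_from_0[of a 1]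
    by (intro absolutely_integrable_onI nonnegative_absolutely_integrable_1) auto
  then have "set_integrable lborel {0..1} (\<lambda>x::real. x powr a)"
    by (simp add: set_integrable_def integrable_completion)
  then have *: "integrable lborel (\<lambda>x::real. indicator {0..1} x * x powr a)"
    by (simp add: set_integrable_def)
  have "integrable lborel (\<lambda>x::real. indicator {0..1} (0 + (-1) * x) * (0 + (-1) * x) powr a)"
    using lborel_integrable_real_affine[OF *, of "-1" 0] by simp
  then have "integrable lborel (\<lambda>x::real. indicator {0..1} x * x powr a +
      indicator {0..1} (0 + (-1) * x) * (0 + (-1) * x) powr a)"
    using * by (intro Bochner_Integration.integrable_add)
  \<comment> \<open>The two halves overlap only at 0, where both sides vanish because
    \<open>0 powr a = 0\<close>.\<close>
  then show ?thesis
    by (rule integrable_cong_AE_imp)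
       (auto intro!: AE_I2 simp: indicator_def abs_if)
qed

lemma lborel_integrable_dunkl_weight:
  assumes "\<alpha> > -1"
  shows "integrable lborel (\<lambda>x. indicator {-1..1} x * dunkl_weight \<alpha> x)"
  using integrable_divide_zero[OF lborel_integrable_abs_powr[of "2 * \<alpha> + 1"], of "2 powr (\<alpha> + 1) * Gamma (\<alpha> + 1)"] assms
  by (simp add: dunkl_weight_def)

lemma dunkl_weight_nonneg: "\<alpha> > -1 \<Longrightarrow> 0 \<le> dunkl_weight \<alpha> x"
  unfolding dunkl_weight_def by (intro divide_nonneg_nonneg mult_nonneg_nonneg) (auto intro: less_imp_le)

text \<open>A continuous function is bounded on [-1,1], so a multiple of the integrable weight
  dominates. The form over \<open>lborel\<close> makes reflections and dominated convergence
  available.\<close>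

lemma integral_dunkl_measure:
  fixes f :: "real \<Rightarrow> 'b::euclidean_space"
  assumes "\<alpha> > -1" and "continuous_on {-1..1} f"
  shows "integrable (dunkl_measure \<alpha>) f"
    and "integrable lborel (\<lambda>x. (indicator {-1..1} x * dunkl_weight \<alpha> x) *\<^sub>R f x)"
    and "(\<integral>x. f x \<partial>dunkl_measure \<alpha>) =
         (\<integral>x. (indicator {-1..1} x * dunkl_weight \<alpha> x) *\<^sub>R f x \<partial>lborel)"
proof -
  have [measurable]: "f \<in> borel_measurable (restrict_space lborel {-1..1})"
    using borel_measurable_continuous_on_restrict[OF assms(2)]
    by (subst measurable_cong_sets[OF sets_restrict_space_cong[of lborel borel] refl]) simp_all
  note w = dunkl_weight_nonneg[OF assms(1)]
  have "compact (f ` {-1..1})"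
    using assms(2) by (intro compact_continuous_image) auto
  then obtain B where B: "\<And>x. x \<in> {-1..1} \<Longrightarrow> norm (f x) \<le> B"
    by (meson bounded_iff compact_imp_bounded imageI)
  have meas: "(\<lambda>x. indicator {-1..1} x *\<^sub>R f x) \<in> borel_measurable lborel"
    using assms(2) borel_measurable_continuous_on_indicator[of "{-1..1}" f] by simp
  show i: "integrable lborel (\<lambda>x. (indicator {-1..1} x * dunkl_weight \<alpha> x) *\<^sub>R f x)"
  proof (rule Bochner_Integration.integrable_bound)
    show "integrable lborel (\<lambda>x. B * (indicator {-1..1} x * dunkl_weight \<alpha> x))"
      using lborel_integrable_dunkl_weight[OF assms(1)] by (rule integrable_mult_right)
    have "(\<lambda>x. dunkl_weight \<alpha> x *\<^sub>R (indicator {-1..1} x *\<^sub>R f x)) \<in> borel_measurable lborel"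
      using meas by measurable
    then show "(\<lambda>x. (indicator {-1..1} x * dunkl_weight \<alpha> x) *\<^sub>R f x) \<in> borel_measurable lborel"
      by (simp add: mult.commute)
    have "norm ((indicator {-1..1} x * dunkl_weight \<alpha> x) *\<^sub>R f x)
        \<le> norm (B * (indicator {-1..1} x * dunkl_weight \<alpha> x))" for x
    proof (cases "x \<in> {-1..1}")
      case True
      have "norm (f x) \<le> \<bar>B\<bar>" using B[OF True] by linarith
      then have "dunkl_weight \<alpha> x * norm (f x) \<le> dunkl_weight \<alpha> x * \<bar>B\<bar>"
        using w by (rule mult_left_mono)
      moreover have "\<bar>dunkl_weight \<alpha> x\<bar> = dunkl_weight \<alpha> x"
        using w by (rule abs_of_nonneg)
      ultimately show ?thesis using True
        by (simp only: norm_scaleR real_norm_def abs_mult indicator_simps mult_1 abs_one) (simp add: mult.commute)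
    qed simp
    then show "AE x in lborel. norm ((indicator {-1..1} x * dunkl_weight \<alpha> x) *\<^sub>R f x)
        \<le> norm (B * (indicator {-1..1} x * dunkl_weight \<alpha> x))"
      by (rule AE_I2)
  qed
  have "integrable (restrict_space lborel {-1..1}) (\<lambda>x. dunkl_weight \<alpha> x *\<^sub>R f x)"
    using i by (subst integrable_restrict_space) (simp_all add: ac_simps)
  then show "integrable (dunkl_measure \<alpha>) f"
    unfolding dunkl_measure_eq using w by (subst integrable_density) (simp_all add: measurable_restrict_space1)
  show "(\<integral>x. f x \<partial>dunkl_measure \<alpha>) =
         (\<integral>x. (indicator {-1..1} x * dunkl_weight \<alpha> x) *\<^sub>R f x \<partial>lborel)"
    unfolding dunkl_measure_eq using w
    by (subst integral_density) (simp_all add: integral_restrict_space measurable_restrict_space1 ac_simps)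
qed

text \<open>Folding the integral onto (0,1) removes the absolute value from the weight and pairs x
  with -x, so that the reflection term of the Dunkl operator is accessible to calculus on a
  half-line.\<close>

lemma integral_dunkl_measure_even:
  fixes h :: "real \<Rightarrow> complex"
  assumes "\<alpha> > -1" and "continuous_on {-1..1} h"
  shows "set_integrable lborel {0<..<1} (\<lambda>x. dunkl_weight \<alpha> x *\<^sub>R (h x + h (- x)))"
    and "(\<integral>x. h x \<partial>dunkl_measure \<alpha>) =
         (LINT x:{0<..<1}|lborel. dunkl_weight \<alpha> x *\<^sub>R (h x + h (- x)))"
proof -
  define p where "p \<sigma> x = (indicator {0<..<1} x * dunkl_weight \<alpha> x) *\<^sub>R h (\<sigma> * x)" for \<sigma> x :: real
  have ip: "integrable lborel (p \<sigma>)" if "\<sigma> = 1 \<or> \<sigma> = -1" for \<sigma>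
  proof -
    have "continuous_on {-1..1} (\<lambda>x. h (\<sigma> * x))"
      using that by (intro continuous_on_compose2[OF assms(2)] continuous_intros) auto
    from integral_dunkl_measure(2)[OF assms(1) this]
    have "integrable lborel (\<lambda>x. indicator {0<..<1} x *\<^sub>R ((indicator {-1..1} x * dunkl_weight \<alpha> x) *\<^sub>R h (\<sigma> * x)))"
      by (intro integrable_mult_indicator) auto
    also have "(\<lambda>x. indicator {0<..<1} x *\<^sub>R ((indicator {-1..1} x * dunkl_weight \<alpha> x) *\<^sub>R h (\<sigma> * x))) = p \<sigma>"
      by (auto simp: p_def fun_eq_iff indicator_def)
    finally show ?thesis .
  qed
  have eq: "p 1 x + p (-1) x = indicator {0<..<1} x *\<^sub>R (dunkl_weight \<alpha> x *\<^sub>R (h x + h (- x)))" for x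
    by (simp add: p_def scaleR_add_right)
  have "integrable lborel (\<lambda>x. p 1 x + p (-1) x)"
    by (intro Bochner_Integration.integrable_add ip) auto
  then show "set_integrable lborel {0<..<1} (\<lambda>x. dunkl_weight \<alpha> x *\<^sub>R (h x + h (- x)))"
    unfolding eq set_integrable_def .
  have ip': "integrable lborel (\<lambda>x. p (-1) (- x))"
    using lborel_integrable_real_affine[OF ip[of "-1"], of "-1" 0] by simp
  have "(\<integral>x. h x \<partial>dunkl_measure \<alpha>) = (\<integral>x. p 1 x + p (-1) (- x) \<partial>lborel)"
    unfolding integral_dunkl_measure(3)[OF assms]
  proof (rule integral_cong_AE)
    show "(\<lambda>x. (indicator {-1..1} x * dunkl_weight \<alpha> x) *\<^sub>R h x) \<in> borel_measurable lborel"
      using integral_dunkl_measure(2)[OF assms] by (rule borel_measurable_integrable)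
    show "(\<lambda>x. p 1 x + p (- 1) (- x)) \<in> borel_measurable lborel"
      using ip[of 1] ip' by (intro borel_measurable_integrable Bochner_Integration.integrable_add) auto
    have "AE x in lborel. x \<noteq> 0 \<and> x \<noteq> 1 \<and> x \<noteq> (-1::real)"
      using AE_lborel_singleton by (auto intro!: AE_conjI)
    then show "AE x in lborel. (indicator {-1..1} x * dunkl_weight \<alpha> x) *\<^sub>R h x = p 1 x + p (- 1) (- x)"
      by eventually_elim (auto simp: p_def indicator_def dunkl_weight_def)
  qed
  also have "\<dots> = (\<integral>x. p 1 x \<partial>lborel) + (\<integral>x. p (-1) (- x) \<partial>lborel)"
    using ip[of 1] ip' by (intro Bochner_Integration.integral_add) auto
  also have "(\<integral>x. p (-1) (- x) \<partial>lborel) = (\<integral>x. p (-1) x \<partial>lborel)"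
    using lborel_integral_real_affine[of "-1" "p (-1)" 0] by simp
  also have "(\<integral>x. p 1 x \<partial>lborel) + (\<integral>x. p (-1) x \<partial>lborel) = (\<integral>x. p 1 x + p (-1) x \<partial>lborel)"
    using ip by (intro Bochner_Integration.integral_add [symmetric]) auto
  finally show "(\<integral>x. h x \<partial>dunkl_measure \<alpha>) =
         (LINT x:{0<..<1}|lborel. dunkl_weight \<alpha> x *\<^sub>R (h x + h (- x)))"
    unfolding eq set_lebesgue_integral_def .
qed

section \<open>The Dunkl operator and its antisymmetry\<close>

text \<open>
  \<^term>\<open>g\<close> is the Dunkl operator
  \<open>\<Lambda> f (x) = f' (x) + (2\<alpha>+1) (f (x) - f (-x)) / (2x)\<close> applied to \<^term>\<open>f\<close>; its value at \<open>0\<close>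
  is fixed by requiring continuity.
\<close>

definition has_dunkl_deriv :: "real \<Rightarrow> (real \<Rightarrow> complex) \<Rightarrow> (real \<Rightarrow> complex) \<Rightarrow> bool" where
  "has_dunkl_deriv \<alpha> f g \<longleftrightarrow> continuous_on UNIV g \<and>
     (\<exists>f'. \<forall>x. (f has_vector_derivative f' x) (at x) \<and>
        (x \<noteq> 0 \<longrightarrow> g x = f' x + of_real ((2 * \<alpha> + 1) / (2 * x)) * (f x - f (- x))))"

lemma has_dunkl_deriv_continuous:
  assumes "has_dunkl_deriv \<alpha> f g"
  shows "continuous_on A f" "continuous_on A g"
proof -
  obtain f' where "(f has_vector_derivative f' x) (at x)" for x
    using assms unfolding has_dunkl_deriv_def by blast
  then have "isCont f x" for x
    by (rule has_vector_derivative_continuous)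
  then show "continuous_on A f"
    by (simp add: continuous_at_imp_continuous_on)
  show "continuous_on A g"
    using assms unfolding has_dunkl_deriv_def by (meson continuous_on_subset subset_UNIV)
qed

lemma has_dunkl_deriv_add:
  assumes "has_dunkl_deriv \<alpha> f f1" "has_dunkl_deriv \<alpha> g g1"
  shows "has_dunkl_deriv \<alpha> (\<lambda>x. f x + g x) (\<lambda>x. f1 x + g1 x)"
proof -
  obtain f' where f': "\<And>x. (f has_vector_derivative f' x) (at x)"
      "\<And>x. x \<noteq> 0 \<Longrightarrow> f1 x = f' x + of_real ((2 * \<alpha> + 1) / (2 * x)) * (f x - f (- x))"
    using assms(1) unfolding has_dunkl_deriv_def by blast
  obtain g' where g': "\<And>x. (g has_vector_derivative g' x) (at x)"
      "\<And>x. x \<noteq> 0 \<Longrightarrow> g1 x = g' x + of_real ((2 * \<alpha> + 1) / (2 * x)) * (g x - g (- x))"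
    using assms(2) unfolding has_dunkl_deriv_def by blast
  show ?thesis
    unfolding has_dunkl_deriv_def
  proof (intro conjI exI[of _ "\<lambda>x. f' x + g' x"] allI impI)
    show "continuous_on UNIV (\<lambda>x. f1 x + g1 x)"
      using assms by (intro continuous_intros has_dunkl_deriv_continuous)
    show "((\<lambda>x. f x + g x) has_vector_derivative f' x + g' x) (at x)" for x
      by (intro derivative_intros f' g')
    show "f1 x + g1 x = f' x + g' x + of_real ((2 * \<alpha> + 1) / (2 * x)) * (f x + g x - (f (- x) + g (- x)))"
      if "x \<noteq> 0" for x
      unfolding f'(2)[OF that] g'(2)[OF that] by algebra
  qed
qed

lemma has_dunkl_deriv_cmult:
  assumes "has_dunkl_deriv \<alpha> f f1"
  shows "has_dunkl_deriv \<alpha> (\<lambda>x. c * f x) (\<lambda>x. c * f1 x)"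
proof -
  obtain f' where f': "\<And>x. (f has_vector_derivative f' x) (at x)"
      "\<And>x. x \<noteq> 0 \<Longrightarrow> f1 x = f' x + of_real ((2 * \<alpha> + 1) / (2 * x)) * (f x - f (- x))"
    using assms(1) unfolding has_dunkl_deriv_def by blast
  show ?thesis
    unfolding has_dunkl_deriv_def
  proof (intro conjI exI[of _ "\<lambda>x. c * f' x"] allI impI)
    show "continuous_on UNIV (\<lambda>x. c * f1 x)"
      using assms by (intro continuous_intros has_dunkl_deriv_continuous)
    show "((\<lambda>x. c * f x) has_vector_derivative c * f' x) (at x)" for x
      by (intro derivative_intros f')
    show "c * f1 x = c * f' x + of_real ((2 * \<alpha> + 1) / (2 * x)) * (c * f x - c * f (- x))"
      if "x \<noteq> 0" for x
      unfolding f'(2)[OF that] by algebra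
  qed
qed

lemma has_dunkl_deriv_const: "has_dunkl_deriv \<alpha> (\<lambda>x. c) (\<lambda>x. 0)"
  unfolding has_dunkl_deriv_def
  by (intro conjI exI[of _ "\<lambda>x. 0"] allI impI) (auto intro: derivative_intros)

lemma has_dunkl_deriv_sum:
  assumes "\<And>i. i \<in> A \<Longrightarrow> has_dunkl_deriv \<alpha> (f i) (g i)"
  shows "has_dunkl_deriv \<alpha> (\<lambda>x. \<Sum>i\<in>A. f i x) (\<lambda>x. \<Sum>i\<in>A. g i x)"
  using assms
  by (induction A rule: infinite_finite_induct)
     (auto intro: has_dunkl_deriv_const has_dunkl_deriv_add)

lemma has_dunkl_deriv_cnj:
  assumes "has_dunkl_deriv \<alpha> f f1"
  shows "has_dunkl_deriv \<alpha> (\<lambda>x. cnj (f x)) (\<lambda>x. cnj (f1 x))"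
proof -
  obtain f' where f': "\<And>x. (f has_vector_derivative f' x) (at x)"
      "\<And>x. x \<noteq> 0 \<Longrightarrow> f1 x = f' x + of_real ((2 * \<alpha> + 1) / (2 * x)) * (f x - f (- x))"
    using assms(1) unfolding has_dunkl_deriv_def by blast
  show ?thesis
    unfolding has_dunkl_deriv_def
  proof (intro conjI exI[of _ "\<lambda>x. cnj (f' x)"] allI impI)
    show "continuous_on UNIV (\<lambda>x. cnj (f1 x))"
      using assms by (intro continuous_intros has_dunkl_deriv_continuous)
    show "((\<lambda>x. cnj (f x)) has_vector_derivative cnj (f' x)) (at x)" for x
      by (intro derivative_intros f')
    show "cnj (f1 x) = cnj (f' x) + of_real ((2 * \<alpha> + 1) / (2 * x)) * (cnj (f x) - cnj (f (- x)))"
      if "x \<noteq> 0" for x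
      unfolding f'(2)[OF that] by simp
  qed
qed

text \<open>Folded onto (0,1), the weighted integrand is the derivative of \<open>H\<close>, which
  is x^(2\<alpha>+1) times twice the odd part of f g, up to a constant. At 1 it vanishes by
  \<open>bd\<close>, at 0 because an odd function supplies one more power of x.\<close>

lemma integral_has_dunkl_deriv_by_parts:
  assumes \<alpha>: "\<alpha> > -1"
    and f: "has_dunkl_deriv \<alpha> f f1" and g: "has_dunkl_deriv \<alpha> g g1"
    and bd: "f 1 * g 1 = f (-1) * g (-1)"
  shows "(\<integral>x. f1 x * g x + f x * g1 x \<partial>dunkl_measure \<alpha>) = 0"
proof -
  obtain f' where f': "\<And>x. (f has_vector_derivative f' x) (at x)"
      "\<And>x. x \<noteq> 0 \<Longrightarrow> f1 x = f' x + of_real ((2 * \<alpha> + 1) / (2 * x)) * (f x - f (- x))"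
    using f unfolding has_dunkl_deriv_def by blast
  obtain g' where g': "\<And>x. (g has_vector_derivative g' x) (at x)"
      "\<And>x. x \<noteq> 0 \<Longrightarrow> g1 x = g' x + of_real ((2 * \<alpha> + 1) / (2 * x)) * (g x - g (- x))"
    using g unfolding has_dunkl_deriv_def by blast
  define h where "h x = f1 x * g x + f x * g1 x" for x
  define D where "D x = f x * g x - f (- x) * g (- x)" for x
  define c where "c = 2 powr (\<alpha> + 1) * Gamma (\<alpha> + 1)"
  have c0: "c \<noteq> 0"
  proof -
    have "Gamma (\<alpha> + 1) > 0" using \<alpha> by (intro Gamma_real_pos) auto
    then show ?thesis by (auto simp: c_def)
  qed
  define D' where "D' x = (f x * g' x + f' x * g x) +
     (f (- x) * g' (- x) + f' (- x) * g (- x))" for x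
  have cont: "continuous_on A f" "continuous_on A f1" "continuous_on A g" "continuous_on A g1" for A
    using f g by (auto intro: has_dunkl_deriv_continuous)
  have conth: "continuous_on A h" for A
    unfolding h_def by (intro continuous_intros cont)
  have refl: "((\<lambda>x. p (- x)) has_vector_derivative - q (- x)) (at x)"
    if "\<And>x. (p has_vector_derivative q x) (at x)" for p q :: "real \<Rightarrow> complex" and x
    using vector_diff_chain_at[of "\<lambda>x. - x" "-1" x p "q (- x)"] that has_vector_derivative_minus[OF has_vector_derivative_id] by (simp add: o_def)
  have Dd: "(D has_vector_derivative D' x) (at x)" for x
    unfolding D_def D'_def
    by (rule derivative_eq_intros f' g' refl | simp)+
  \<comment> \<open>The four reflection terms at x and -x add up to a multiple of \<open>D x\<close>
    alone; the mixed products of values at x and -x cancel.\<close>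
  have hh: "h x + h (- x) = D' x + of_real ((2 * \<alpha> + 1) / x) * D x" if "x > 0" for x
  proof -
    have "x \<noteq> 0" "- x \<noteq> 0" using that by auto
    then show ?thesis
      unfolding h_def D_def D'_def f'(2)[OF \<open>x \<noteq> 0\<close>] f'(2)[OF \<open>- x \<noteq> 0\<close>]
        g'(2)[OF \<open>x \<noteq> 0\<close>] g'(2)[OF \<open>- x \<noteq> 0\<close>]
      by (simp add: field_simps)
  qed
  define H where "H x = of_real (x powr (2 * \<alpha> + 1) / c) * D x" for x :: real
  have "(LBINT x=ereal 0..ereal 1. dunkl_weight \<alpha> x *\<^sub>R (h x + h (- x))) = 0 - 0"
  proof (rule interval_integral_FTC_integrable[where F = H])
    fix x assume "ereal 0 < ereal x" "ereal x < ereal 1"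
    then have x: "x > 0" by simp
    have "((\<lambda>x. x powr (2 * \<alpha> + 1) / c) has_real_derivative
             (2 * \<alpha> + 1) * x powr (2 * \<alpha>) / c) (at x)"
      using x c0 by (auto intro!: derivative_eq_intros)
    then have "((\<lambda>x. complex_of_real (x powr (2 * \<alpha> + 1) / c)) has_vector_derivative
             of_real ((2 * \<alpha> + 1) * x powr (2 * \<alpha>) / c)) (at x)"
      by (rule has_vector_derivative_of_real)
    then have "(H has_vector_derivative of_real (x powr (2 * \<alpha> + 1) / c) * D' x
         + of_real ((2 * \<alpha> + 1) * x powr (2 * \<alpha>) / c) * D x) (at x)"
      unfolding H_def by (intro has_vector_derivative_mult Dd)
    also have "of_real (x powr (2 * \<alpha> + 1) / c) * D' x
         + of_real ((2 * \<alpha> + 1) * x powr (2 * \<alpha>) / c) * D x = dunkl_weight \<alpha> x *\<^sub>R (h x + h (- x))"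
    proof -
      have "x powr (2 * \<alpha>) = x powr (2 * \<alpha> + 1) / x"
        using x by (simp add: powr_add)
      then have 1: "(2 * \<alpha> + 1) * x powr (2 * \<alpha>) / c = (2 * \<alpha> + 1) * (x powr (2 * \<alpha> + 1) / c / x)"
        by simp
      have 2: "dunkl_weight \<alpha> x = x powr (2 * \<alpha> + 1) / c"
        using x by (simp add: dunkl_weight_def c_def)
      have "of_real w * D' x + of_real ((2 * \<alpha> + 1) * (w / x)) * D x =
          w *\<^sub>R (D' x + of_real ((2 * \<alpha> + 1) / x) * D x)" for w
        by (simp add: scaleR_conv_of_real algebra_simps add_divide_distrib)
      then show ?thesis unfolding hh[OF x] 1 2 .
    qed
    finally show "(H has_vector_derivative dunkl_weight \<alpha> x *\<^sub>R (h x + h (- x))) (at x)" .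
    have "isCont h y" for y
      using conth[of UNIV] by (simp add: continuous_on_eq_continuous_at)
    then have "isCont (\<lambda>x. h (- x)) x"
      by (intro continuous_within_compose2[where g = h and f = uminus]) (auto intro!: continuous_intros simp: continuous_at_imp_continuous_within)
    with \<open>\<And>y. isCont h y\<close> show "isCont (\<lambda>x. dunkl_weight \<alpha> x *\<^sub>R (h x + h (- x))) x"
      using x c0 unfolding dunkl_weight_def c_def [symmetric]
      by (intro continuous_intros) auto
  next
    show "set_integrable lborel (einterval (ereal 0) (ereal 1))
        (\<lambda>x. dunkl_weight \<alpha> x *\<^sub>R (h x + h (- x)))"
      using integral_dunkl_measure_even(1)[OF \<alpha> conth] by (simp add: einterval_eq)
  next
    \<comment> \<open>The power x^(2\<alpha>+1) may blow up at 0. Since \<open>D 0 = 0\<close>, the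
      quotient D(x)/x converges, and the remaining power x^(2\<alpha>+2) tends to 0.\<close>
    have "((\<lambda>h. cmod (D h - D 0 - h *\<^sub>R D' 0) / \<bar>h\<bar>) \<longlongrightarrow> 0) (at 0)"
      using Dd[of 0] by (simp add: has_vector_derivative_def has_derivative_at)
    moreover have "\<forall>\<^sub>F h in at 0. cmod (D h - D 0 - h *\<^sub>R D' 0) / \<bar>h\<bar> = norm (D h /\<^sub>R h - D' 0)"
    proof (rule eventually_at_filter[THEN iffD2], rule always_eventually, intro allI impI)
      fix h :: real assume "h \<noteq> 0"
      then have "D h /\<^sub>R h - D' 0 = (D h - D 0 - h *\<^sub>R D' 0) /\<^sub>R h"
        by (simp add: D_def scaleR_diff_right)
      then show "cmod (D h - D 0 - h *\<^sub>R D' 0) / \<bar>h\<bar> = norm (D h /\<^sub>R h - D' 0)"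
        by (simp add: divide_inverse mult.commute)
    qed
    ultimately have "((\<lambda>h. norm (D h /\<^sub>R h - D' 0)) \<longlongrightarrow> 0) (at 0)"
      by (rule Lim_transform_eventually)
    then have "((\<lambda>x. D x /\<^sub>R x) \<longlongrightarrow> D' 0) (at 0)"
      by (simp only: tendsto_norm_zero_iff LIM_zero_iff)
    then have "((\<lambda>x. D x /\<^sub>R x) \<longlongrightarrow> D' 0) (at_right 0)"
      by (simp add: filterlim_at_split)
    moreover have "((\<lambda>x. x powr (2 * \<alpha> + 2)) \<longlongrightarrow> 0) (at_right (0::real))"
      using \<alpha> by (intro tendsto_zero_powrI[of _ _ _ "2 * \<alpha> + 2"] tendsto_intros)
        (auto simp: eventually_at_filter)
    then have "((\<lambda>x. x powr (2 * \<alpha> + 2) / c) \<longlongrightarrow> 0) (at_right (0::real))"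
      using c0 by (auto intro: tendsto_eq_intros)
    ultimately have "((\<lambda>x. (x powr (2 * \<alpha> + 2) / c) *\<^sub>R (D x /\<^sub>R x)) \<longlongrightarrow> 0 *\<^sub>R D' 0) (at_right 0)"
      by (intro tendsto_intros)
    moreover have "\<forall>\<^sub>F x in at_right 0. (x powr (2 * \<alpha> + 2) / c) *\<^sub>R (D x /\<^sub>R x) = H x"
      using eventually_at_right_less[of 0]
    proof eventually_elim
      case (elim x)
      then have "x powr (2 * \<alpha> + 2) = x powr (2 * \<alpha> + 1) * x"
        by (simp add: powr_add powr_numeral power2_eq_square)
      then show ?case using elim
        by (simp add: H_def scaleR_conv_of_real)
    qed
    ultimately have "(H \<longlongrightarrow> 0) (at_right 0)"
      by (simp add: tendsto_cong)
    then show "((H \<circ> real_of_ereal) \<longlongrightarrow> 0) (at_right (ereal 0))"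
      by (rule ereal_tendsto_simps(2)[THEN iffD2])
  next
    have "isCont H 1"
    proof -
      have "isCont D 1" using Dd by (rule has_vector_derivative_continuous)
      then show ?thesis unfolding H_def using c0 by (intro continuous_intros) auto
    qed
    then have "(H \<longlongrightarrow> H 1) (at_left 1)"
      by (simp add: isCont_def filterlim_at_split)
    moreover have "H 1 = 0" using bd by (simp add: H_def D_def)
    ultimately show "((H \<circ> real_of_ereal) \<longlongrightarrow> 0) (at_left (ereal 1))"
      by (simp add: ereal_tendsto_simps)
  qed simp
  then have "(LINT x:{0<..<1}|lborel. dunkl_weight \<alpha> x *\<^sub>R (h x + h (- x))) = 0"
    by (simp add: interval_lebesgue_integral_def einterval_eq)
  then have "(\<integral>x. h x \<partial>dunkl_measure \<alpha>) = 0"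
    by (simp add: integral_dunkl_measure_even(2)[OF \<alpha> conth])
  then show ?thesis by (simp add: h_def)
qed

section \<open>The Hermitian form and the norm of L^2 for the Dunkl measure\<close>

definition dunkl_inner :: "real \<Rightarrow> (real \<Rightarrow> complex) \<Rightarrow> (real \<Rightarrow> complex) \<Rightarrow> complex" where
  "dunkl_inner \<alpha> f g = (\<integral>x. f x * cnj (g x) \<partial>dunkl_measure \<alpha>)"

text \<open>Integration by parts with the conjugate of \<open>g\<close>: the operator has real
  coefficients and so commutes with conjugation. Equal values at 1 and -1 remove the boundary
  term.\<close>

lemma dunkl_inner_antisym:
  assumes "\<alpha> > -1" "has_dunkl_deriv \<alpha> f f1" "has_dunkl_deriv \<alpha> g g1"
    and "f 1 = f (-1)" "g 1 = g (-1)"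
  shows "dunkl_inner \<alpha> f1 g = - dunkl_inner \<alpha> f g1"
proof -
  have "(\<integral>x. f1 x * cnj (g x) + f x * cnj (g1 x) \<partial>dunkl_measure \<alpha>) = 0"
    using assms by (intro integral_has_dunkl_deriv_by_parts has_dunkl_deriv_cnj) auto
  moreover have "integrable (dunkl_measure \<alpha>) (\<lambda>x. f1 x * cnj (g x))"
      "integrable (dunkl_measure \<alpha>) (\<lambda>x. f x * cnj (g1 x))"
    using assms by (intro integral_dunkl_measure(1) continuous_intros
        has_dunkl_deriv_continuous; force intro: has_dunkl_deriv_continuous)+
  ultimately show ?thesis
    unfolding dunkl_inner_def by (simp add: add_eq_0_iff2)
qed

lemma norm_L2_nonneg: "norm_L2 M f \<ge> 0"
  by (simp add: norm_L2_def)

lemma norm_L2_power2: "(norm_L2 M f)\<^sup>2 = (\<integral>x. (cmod (f x))\<^sup>2 \<partial>M)"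
  by (simp add: norm_L2_def)

lemma norm_L2_cmult: "norm_L2 M (\<lambda>x. c * f x) = cmod c * norm_L2 M f"
  by (simp add: norm_L2_def norm_mult power_mult_distrib real_sqrt_mult)

lemma dunkl_inner_cmult_left: "dunkl_inner \<alpha> (\<lambda>x. c * f x) g = c * dunkl_inner \<alpha> f g"
  by (simp add: dunkl_inner_def mult.assoc)

lemma dunkl_inner_commute: "dunkl_inner \<alpha> g f = cnj (dunkl_inner \<alpha> f g)"
  unfolding dunkl_inner_def by (subst Bochner_Integration.integral_cnj [symmetric]) (simp add: mult.commute)

lemma dunkl_inner_self: "dunkl_inner \<alpha> f f = of_real ((norm_L2 (dunkl_measure \<alpha>) f)\<^sup>2)"
  unfolding dunkl_inner_def norm_L2_power2 complex_norm_square [symmetric]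
  by (rule integral_complex_of_real)

context
  fixes \<alpha> :: real
  assumes \<alpha>: "\<alpha> > -1"
begin

lemma integrable_dunkl_inner:
  assumes "continuous_on UNIV f" "continuous_on UNIV g"
  shows "integrable (dunkl_measure \<alpha>) (\<lambda>x. f x * cnj (g x))"
  using assms by (intro integral_dunkl_measure(1)[OF \<alpha>] continuous_intros)
    (auto intro: continuous_on_subset)

lemma dunkl_inner_add_left:
  assumes "continuous_on UNIV f" "continuous_on UNIV g" "continuous_on UNIV h"
  shows "dunkl_inner \<alpha> (\<lambda>x. f x + g x) h = dunkl_inner \<alpha> f h + dunkl_inner \<alpha> g h"
  unfolding dunkl_inner_def using assms
  by (simp add: distrib_right integrable_dunkl_inner)

lemma dunkl_inner_sum_left:
  assumes "\<And>i. i \<in> A \<Longrightarrow> continuous_on UNIV (f i)" "continuous_on UNIV h"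
  shows "dunkl_inner \<alpha> (\<lambda>x. \<Sum>i\<in>A. f i x) h = (\<Sum>i\<in>A. dunkl_inner \<alpha> (f i) h)"
  unfolding dunkl_inner_def using assms
  by (simp add: sum_distrib_right Bochner_Integration.integral_sum integrable_dunkl_inner)

lemma square_integrable_dunkl_measure:
  assumes "continuous_on UNIV f"
  shows "square_integrable (dunkl_measure \<alpha>) f"
proof -
  have "continuous_on {-1..1} f" using assms by (rule continuous_on_subset) auto
  then show ?thesis unfolding square_integrable_def
    by (intro conjI borel_measurable_dunkl_measure integral_dunkl_measure(1)[OF \<alpha>] continuous_intros)
qed

lemma dunkl_inner_Cauchy_Schwarz:
  assumes f: "continuous_on UNIV f" and g: "continuous_on UNIV g"
  shows "cmod (dunkl_inner \<alpha> f g) \<le> norm_L2 (dunkl_measure \<alpha>) f * norm_L2 (dunkl_measure \<alpha>) g"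
proof -
  let ?M = "dunkl_measure \<alpha>"
  have [measurable]: "f \<in> borel_measurable ?M" "g \<in> borel_measurable ?M"
    using assms by (auto intro!: borel_measurable_dunkl_measure intro: continuous_on_subset)
  have int: "integrable ?M (\<lambda>x. (cmod (f x))\<^sup>2)" "integrable ?M (\<lambda>x. (cmod (g x))\<^sup>2)"
    using assms square_integrable_dunkl_measure by (auto simp: square_integrable_def)
  have int': "integrable ?M (\<lambda>x. cmod (f x) * cmod (g x))"
    using integrable_norm[OF integrable_dunkl_inner[OF assms]] by (simp add: norm_mult)
  define I where "I = (\<integral>x. cmod (f x) * cmod (g x) \<partial>?M)"
  have I0: "I \<ge> 0" unfolding I_def by simp
  have "ennreal I = (\<integral>\<^sup>+x. ennreal (cmod (f x)) * ennreal (cmod (g x)) \<partial>?M)"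
    unfolding I_def using int' by (subst nn_integral_eq_integral [symmetric]) (auto simp: ennreal_mult)
  then have "ennreal I ^ 2 \<le> (\<integral>\<^sup>+x. ennreal (cmod (f x)) ^ 2 \<partial>?M) * (\<integral>\<^sup>+x. ennreal (cmod (g x)) ^ 2 \<partial>?M)"
    using Cauchy_Schwarz_nn_integral[of "\<lambda>x. ennreal (cmod (f x))" ?M "\<lambda>x. ennreal (cmod (g x))"] by simp
  also have "(\<integral>\<^sup>+x. ennreal (cmod (f x)) ^ 2 \<partial>?M) = ennreal ((norm_L2 ?M f)\<^sup>2)"
    unfolding norm_L2_power2 using int by (subst nn_integral_eq_integral [symmetric]) (auto simp: ennreal_power)
  also have "(\<integral>\<^sup>+x. ennreal (cmod (g x)) ^ 2 \<partial>?M) = ennreal ((norm_L2 ?M g)\<^sup>2)"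
    unfolding norm_L2_power2 using int by (subst nn_integral_eq_integral [symmetric]) (auto simp: ennreal_power)
  finally have "I\<^sup>2 \<le> (norm_L2 ?M f * norm_L2 ?M g)\<^sup>2"
    using I0 by (simp add: ennreal_power ennreal_mult [symmetric] power_mult_distrib)
  then have "I \<le> norm_L2 ?M f * norm_L2 ?M g"
    by (rule power2_le_imp_le) (simp add: norm_L2_nonneg)
  moreover have "cmod (dunkl_inner \<alpha> f g) \<le> I"
    unfolding dunkl_inner_def I_def
    using integral_norm_bound[of ?M "\<lambda>x. f x * cnj (g x)"] by (simp add: norm_mult)
  ultimately show ?thesis by linarith
qed

lemma norm_L2_add_power2:
  assumes "continuous_on UNIV f" "continuous_on UNIV g"
  shows "(norm_L2 (dunkl_measure \<alpha>) (\<lambda>x. f x + g x))\<^sup>2 =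
     (norm_L2 (dunkl_measure \<alpha>) f)\<^sup>2 + 2 * Re (dunkl_inner \<alpha> f g) + (norm_L2 (dunkl_measure \<alpha>) g)\<^sup>2"
proof -
  have "cmod (f x + g x) ^ 2 = cmod (f x) ^ 2 + 2 * Re (f x * cnj (g x)) + cmod (g x) ^ 2" for x
    unfolding cmod_power2 by (simp add: power2_eq_square algebra_simps)
  moreover have "Re (dunkl_inner \<alpha> f g) = (\<integral>x. Re (f x * cnj (g x)) \<partial>dunkl_measure \<alpha>)"
    unfolding dunkl_inner_def using integral_Re[OF integrable_dunkl_inner[OF assms]] by simp
  moreover have "integrable (dunkl_measure \<alpha>) (\<lambda>x. (cmod (f x))\<^sup>2)" "integrable (dunkl_measure \<alpha>) (\<lambda>x. (cmod (g x))\<^sup>2)"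
    using assms square_integrable_dunkl_measure by (auto simp: square_integrable_def)
  moreover have "integrable (dunkl_measure \<alpha>) (\<lambda>x. Re (f x * cnj (g x)))"
    using integrable_Re[OF integrable_dunkl_inner[OF assms]] by simp
  ultimately show ?thesis
    unfolding norm_L2_power2 by (simp del: complex_cnj_mult times_complex.simps)
qed

lemma norm_L2_triangle:
  assumes "continuous_on UNIV f" "continuous_on UNIV g"
  shows "norm_L2 (dunkl_measure \<alpha>) (\<lambda>x. f x + g x) \<le>
     norm_L2 (dunkl_measure \<alpha>) f + norm_L2 (dunkl_measure \<alpha>) g"
proof (rule power2_le_imp_le)
  have "Re (dunkl_inner \<alpha> f g) \<le> norm_L2 (dunkl_measure \<alpha>) f * norm_L2 (dunkl_measure \<alpha>) g"
    using dunkl_inner_Cauchy_Schwarz[OF assms] complex_Re_le_cmod order_trans by blast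
  then show "(norm_L2 (dunkl_measure \<alpha>) (\<lambda>x. f x + g x))\<^sup>2 \<le>
     (norm_L2 (dunkl_measure \<alpha>) f + norm_L2 (dunkl_measure \<alpha>) g)\<^sup>2"
    unfolding norm_L2_add_power2[OF assms] by (simp add: power2_sum)
qed (simp add: norm_L2_nonneg)

lemma norm_L2_sum_le:
  assumes "\<And>i. i \<in> A \<Longrightarrow> continuous_on UNIV (f i)"
  shows "norm_L2 (dunkl_measure \<alpha>) (\<lambda>x. \<Sum>i\<in>A. f i x) \<le> (\<Sum>i\<in>A. norm_L2 (dunkl_measure \<alpha>) (f i))"
  using assms
proof (induction A rule: infinite_finite_induct)
  case (insert a A)
  have "norm_L2 (dunkl_measure \<alpha>) (\<lambda>x. f a x + (\<Sum>i\<in>A. f i x)) \<le>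
      norm_L2 (dunkl_measure \<alpha>) (f a) + norm_L2 (dunkl_measure \<alpha>) (\<lambda>x. \<Sum>i\<in>A. f i x)"
    using insert.prems by (intro norm_L2_triangle continuous_intros) auto
  then show ?case using insert by fastforce
qed (simp_all add: norm_L2_def)

text \<open>Pythagoras: a vector orthogonal to a subspace has the least norm in its coset.\<close>

lemma norm_L2_le_of_orthogonal:
  assumes cont: "continuous_on UNIV r" "\<And>j. j \<in> F \<Longrightarrow> continuous_on UNIV (e j)"
    and orth: "\<And>j. j \<in> F \<Longrightarrow> dunkl_inner \<alpha> r (e j) = 0"
  shows "norm_L2 (dunkl_measure \<alpha>) r \<le> norm_L2 (dunkl_measure \<alpha>) (\<lambda>x. r x + (\<Sum>j\<in>F. c j * e j x))"
proof (rule power2_le_imp_le)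
  have "dunkl_inner \<alpha> (\<lambda>x. \<Sum>j\<in>F. c j * e j x) r = (\<Sum>j\<in>F. c j * dunkl_inner \<alpha> (e j) r)"
    using cont by (subst dunkl_inner_sum_left) (auto intro!: continuous_intros simp: dunkl_inner_cmult_left)
  also have "\<dots> = 0"
    using orth by (subst dunkl_inner_commute) simp
  finally have "dunkl_inner \<alpha> r (\<lambda>x. \<Sum>j\<in>F. c j * e j x) = 0"
    by (subst dunkl_inner_commute) simp
  then show "(norm_L2 (dunkl_measure \<alpha>) r)\<^sup>2 \<le> (norm_L2 (dunkl_measure \<alpha>) (\<lambda>x. r x + (\<Sum>j\<in>F. c j * e j x)))\<^sup>2"
    using cont by (subst norm_L2_add_power2) (auto intro!: continuous_intros)
qed (rule norm_L2_nonneg)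

end

section \<open>Recurrences for \<open>\<I>\<^sub>\<alpha>\<close> and the Dunkl exponential\<close>

lemma dunkl_gamma_pos: "\<alpha> > -1 \<Longrightarrow> dunkl_gamma n \<alpha> > 0"
  unfolding dunkl_gamma_def by (auto intro!: mult_pos_pos pochhammer_pos)

lemma dunkl_gamma_0 [simp]: "dunkl_gamma 0 \<alpha> = 1"
  by (simp add: dunkl_gamma_def)

text \<open>The factor is the one by which the Dunkl operator maps x^(n+1) to x^n; the numbers
  \<open>dunkl_gamma\<close> are the factorials of this operator.\<close>

lemma dunkl_gamma_Suc:
  "dunkl_gamma (Suc n) \<alpha> = (if even n then real n + 2 * \<alpha> + 2 else real n + 1) * dunkl_gamma n \<alpha>"
proof (cases "even n")
  case True
  then obtain k where "n = 2 * k" by (elim evenE)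
  then show ?thesis
    by (simp add: dunkl_gamma_def pochhammer_Suc algebra_simps)
next
  case False
  then obtain k where "n = 2 * k + 1" by (elim oddE)
  then show ?thesis
    by (simp add: dunkl_gamma_def algebra_simps)
qed

lemma dunkl_gamma_odd: "dunkl_gamma (2 * n + 1) \<alpha> = 2 * (\<alpha> + 1) * dunkl_gamma (2 * n) (\<alpha> + 1)"
  using pochhammer_rec[of "\<alpha> + 1" n] by (simp add: dunkl_gamma_def add_ac)

lemma divide_mult_cancel_left_1: "a / (a * b) = 1 / b" if "a \<noteq> 0" for a b :: "'a::field"
  using that by simp

lemma has_field_derivative_bessel_I_norm:
  assumes "\<alpha> > -1"
  shows "(bessel_I_norm \<alpha> has_field_derivative z / (2 * (of_real \<alpha> + 1)) * bessel_I_norm (\<alpha> + 1) z) (at z)"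
proof -
  define c where "c n = (if even n then 1 / complex_of_real (dunkl_gamma n \<alpha>) else 0)" for n
  have s: "(\<lambda>n. c n * w ^ n) sums bessel_I_norm \<alpha> w" for w
    using bessel_I_norm_sums[OF assms, of w]
    by (subst sums_even_reindex [symmetric]) (simp_all add: c_def)
  have eq: "bessel_I_norm \<alpha> = (\<lambda>w. \<Sum>n. c n * w ^ n)"
    using s by (auto simp: sums_iff)
  have "((\<lambda>w. \<Sum>n. c n * w ^ n) has_field_derivative (\<Sum>n. diffs c n * z ^ n)) (at z)"
    using s by (intro termdiffs_strong_converges_everywhere) (auto simp: sums_iff)
  moreover have "(\<lambda>n. diffs c n * z ^ n) sums (z / (2 * (of_real \<alpha> + 1)) * bessel_I_norm (\<alpha> + 1) z)"
  proof (subst sums_odd_reindex [symmetric])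
    have "diffs c (2 * n + 1) * z ^ (2 * n + 1) =
        z / (2 * (of_real \<alpha> + 1)) * (z ^ (2 * n) / of_real (dunkl_gamma (2 * n) (\<alpha> + 1)))" for n
    proof -
      have "dunkl_gamma (2 * n + 2) \<alpha> = (2 * real n + 2) * (2 * (\<alpha> + 1) * dunkl_gamma (2 * n) (\<alpha> + 1))"
        using dunkl_gamma_Suc[of "2 * n + 1" \<alpha>] dunkl_gamma_odd[of n \<alpha>] by simp
      moreover have "diffs c (2 * n + 1) = of_real ((2 * real n + 2) / dunkl_gamma (2 * n + 2) \<alpha>)"
        by (simp add: diffs_def c_def add_ac)
      ultimately have "diffs c (2 * n + 1) = of_real ((2 * real n + 2) / ((2 * real n + 2) * (2 * (\<alpha> + 1) * dunkl_gamma (2 * n) (\<alpha> + 1))))"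
        by (simp only:)
      also have "(2 * real n + 2) / ((2 * real n + 2) * (2 * (\<alpha> + 1) * dunkl_gamma (2 * n) (\<alpha> + 1)))
          = 1 / (2 * (\<alpha> + 1) * dunkl_gamma (2 * n) (\<alpha> + 1))"
        by (rule divide_mult_cancel_left_1) linarith
      finally show ?thesis by (simp add: mult_ac)
    qed
    moreover have "(\<lambda>n. z / (2 * (of_real \<alpha> + 1)) * (z ^ (2 * n) / of_real (dunkl_gamma (2 * n) (\<alpha> + 1))))
        sums (z / (2 * (of_real \<alpha> + 1)) * bessel_I_norm (\<alpha> + 1) z)"
      using assms by (intro sums_mult bessel_I_norm_sums) auto
    ultimately show "(\<lambda>n. diffs c (2 * n + 1) * z ^ (2 * n + 1)) sums
        (z / (2 * (of_real \<alpha> + 1)) * bessel_I_norm (\<alpha> + 1) z)" by simp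
  qed (simp add: diffs_def c_def)
  ultimately show ?thesis
    unfolding eq [symmetric] by (simp add: sums_iff)
qed

lemma of_real_add_neq_0:
  assumes "a + b > 0"
  shows "complex_of_real a + of_real b \<noteq> 0"
  using assms by (metis of_real_add of_real_eq_0_iff less_irrefl)

text \<open>By the derivative formula the left side is z times the derivative of
  \<open>bessel_I_norm (\<alpha> + 1)\<close>, which is thereby expressed through
  \<open>bessel_I_norm \<alpha>\<close>. The proof compares coefficients.\<close>

lemma bessel_I_norm_recurrence:
  assumes "\<alpha> > -1"
  shows "z * (z / (2 * (of_real (\<alpha> + 1) + 1)) * bessel_I_norm (\<alpha> + 1 + 1) z) =
    2 * (of_real \<alpha> + 1) * (bessel_I_norm \<alpha> z - bessel_I_norm (\<alpha> + 1) z)"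
proof -
  let ?f = "\<lambda>n. 2 * (of_real \<alpha> + 1) * (z ^ (2 * n) / of_real (dunkl_gamma (2 * n) \<alpha>)
      - z ^ (2 * n) / of_real (dunkl_gamma (2 * n) (\<alpha> + 1)))"
  have "?f sums (2 * (of_real \<alpha> + 1) * (bessel_I_norm \<alpha> z - bessel_I_norm (\<alpha> + 1) z))"
    using assms by (intro sums_mult sums_diff bessel_I_norm_sums) auto
  \<comment> \<open>Both series start with 1, so the term at index 0 cancels and the difference can
    be shifted.\<close>
  then have "(\<lambda>n. ?f (Suc n)) sums (2 * (of_real \<alpha> + 1) * (bessel_I_norm \<alpha> z - bessel_I_norm (\<alpha> + 1) z))"
    by (subst sums_Suc_iff) simp
  moreover have "?f (Suc n) = z * (z / (2 * (of_real (\<alpha> + 1) + 1)) *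
      (z ^ (2 * n) / of_real (dunkl_gamma (2 * n) (\<alpha> + 1 + 1))))" for n
  proof -
    define P where "P = dunkl_gamma (2 * n) (\<alpha> + 2)"
    have P: "P > 0" unfolding P_def using assms by (intro dunkl_gamma_pos) auto
    have 1: "dunkl_gamma (2 * Suc n) (\<alpha> + 1) = (2 * real n + 2) * (2 * (\<alpha> + 2) * P)"
      using dunkl_gamma_Suc[of "2 * n + 1" "\<alpha> + 1"] dunkl_gamma_odd[of n "\<alpha> + 1"]
      by (simp add: P_def add.commute)
    \<comment> \<open>Both sides are \<open>pochhammer (\<alpha> + 1) (n + 2)\<close>, with its last
      and its first factor split off.\<close>
    have "pochhammer (\<alpha> + 1) (Suc n) * (\<alpha> + 2 + real n) = (\<alpha> + 1) * pochhammer (\<alpha> + 2) (Suc n)"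
      using pochhammer_rec[of "\<alpha> + 1" "Suc n"] pochhammer_Suc[of "\<alpha> + 1" "Suc n"] by (simp add: add_ac)
    then have 2: "dunkl_gamma (2 * Suc n) \<alpha> * (\<alpha> + 2 + real n) = (\<alpha> + 1) * dunkl_gamma (2 * Suc n) (\<alpha> + 1)"
      by (simp add: dunkl_gamma_def add_ac del: pochhammer_Suc)
    have g: "dunkl_gamma (2 * Suc n) \<alpha> > 0" "dunkl_gamma (2 * Suc n) (\<alpha> + 1) > 0"
      using assms by (auto intro: dunkl_gamma_pos)
    have "(\<alpha> + 1) / X = Q / Y" if "X > 0" "Y > 0" "X * Q = (\<alpha> + 1) * Y" for X Y Q :: real
      using that by (simp add: frac_eq_eq mult.commute)
    note quot = this[OF g 2]
    have scale: "2 * (\<alpha> + 1) * (1 / X - 1 / Y) = 2 * ((\<alpha> + 1) / X) - 2 * (\<alpha> + 1) / Y" for X Y :: real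
      by (simp add: right_diff_distrib)
    have "2 * (\<alpha> + 1) * (1 / dunkl_gamma (2 * Suc n) \<alpha> - 1 / dunkl_gamma (2 * Suc n) (\<alpha> + 1)) =
        2 * (\<alpha> + 2 + real n) / dunkl_gamma (2 * Suc n) (\<alpha> + 1) - 2 * (\<alpha> + 1) / dunkl_gamma (2 * Suc n) (\<alpha> + 1)"
      unfolding scale quot by (simp only: times_divide_eq_right)
    also have "\<dots> = (2 * real n + 2) / dunkl_gamma (2 * Suc n) (\<alpha> + 1)"
      by (simp add: diff_divide_distrib [symmetric] del: mult_Suc_right)
    also have "\<dots> = 1 / (2 * (\<alpha> + 2) * P)"
      unfolding 1 by (rule divide_mult_cancel_left_1) linarith
    finally have *: "2 * (\<alpha> + 1) * (1 / dunkl_gamma (2 * Suc n) \<alpha> - 1 / dunkl_gamma (2 * Suc n) (\<alpha> + 1))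
       = 1 / (2 * (\<alpha> + 2) * P)" .
    have "?f (Suc n) = z ^ (2 * Suc n) * of_real (2 * (\<alpha> + 1) * (1 / dunkl_gamma (2 * Suc n) \<alpha> - 1 / dunkl_gamma (2 * Suc n) (\<alpha> + 1)))"
      by (simp add: algebra_simps del: mult_Suc_right)
    also have "\<dots> = z * (z / (2 * (of_real (\<alpha> + 1) + 1)) * (z ^ (2 * n) / of_real (dunkl_gamma (2 * n) (\<alpha> + 1 + 1))))"
      unfolding * by (simp add: P_def add_ac)
    finally show ?thesis .
  qed
  moreover have "(\<lambda>n. z * (z / (2 * (of_real (\<alpha> + 1) + 1)) *
      (z ^ (2 * n) / of_real (dunkl_gamma (2 * n) (\<alpha> + 1 + 1))))) sums
      (z * (z / (2 * (of_real (\<alpha> + 1) + 1)) * bessel_I_norm (\<alpha> + 1 + 1) z))"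
    using assms by (intro sums_mult bessel_I_norm_sums) auto
  ultimately show ?thesis
    by (simp only: sums_unique2)
qed

lemma bessel_I_norm_minus: "bessel_I_norm \<alpha> (- z) = bessel_I_norm \<alpha> z"
  by (simp add: bessel_I_norm_def)

lemma cnj_bessel_I_norm:
  assumes "\<alpha> > -1"
  shows "cnj (bessel_I_norm \<alpha> z) = bessel_I_norm \<alpha> (cnj z)"
  using sums_cnj[THEN iffD2, OF bessel_I_norm_sums[OF assms, of z]] bessel_I_norm_sums[OF assms, of "cnj z"]
  by (simp add: sums_unique2)

lemma dunkl_E_0:
  assumes "\<alpha> > -1"
  shows "dunkl_E \<alpha> 0 = 1"
  using assms by (simp add: dunkl_E_def bessel_I_norm_0)

text \<open>The odd part of \<open>dunkl_E \<alpha>\<close> vanishes at such a point. This is the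
  source of the equal boundary values of the eigenfunctions.\<close>

lemma dunkl_E_minus:
  assumes "bessel_I_norm (\<alpha> + 1) z = 0"
  shows "dunkl_E \<alpha> z = bessel_I_norm \<alpha> z" "dunkl_E \<alpha> (- z) = bessel_I_norm \<alpha> z"
  using assms by (simp_all add: dunkl_E_def bessel_I_norm_minus)

text \<open>The recurrence evaluates the derivative of the odd part. The result is arranged as
  \<open>dunkl_E\<close> minus the term that the reflection part of the Dunkl operator
  restores.\<close>

lemma has_field_derivative_dunkl_E:
  assumes "\<alpha> > -1"
  shows "(dunkl_E \<alpha> has_field_derivative
     dunkl_E \<alpha> z - of_real ((2 * \<alpha> + 1) / (2 * (\<alpha> + 1))) * bessel_I_norm (\<alpha> + 1) z) (at z)"
proof -
  define d where "d = z / (2 * (of_real (\<alpha> + 1) + 1)) * bessel_I_norm (\<alpha> + 1 + 1) z"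
  have nz: "complex_of_real \<alpha> + 1 \<noteq> 0"
    using of_real_add_neq_0[of \<alpha> 1] assms by simp
  have J: "(bessel_I_norm (\<alpha> + 1) has_field_derivative d) (at z)"
    unfolding d_def using assms by (intro has_field_derivative_bessel_I_norm) auto
  have "((\<lambda>z. z / a) has_field_derivative 1 / a) (at z)" for a :: complex
    by (intro DERIV_cdivide DERIV_ident)
  then have "(dunkl_E \<alpha> has_field_derivative
     z / (2 * (of_real \<alpha> + 1)) * bessel_I_norm (\<alpha> + 1) z +
     (z / (2 * (of_real \<alpha> + 1)) * d + 1 / (2 * (of_real \<alpha> + 1)) * bessel_I_norm (\<alpha> + 1) z)) (at z)"
    unfolding dunkl_E_def [abs_def]
    by (intro DERIV_add DERIV_mult' J has_field_derivative_bessel_I_norm assms)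
  also have "z / (2 * (of_real \<alpha> + 1)) * d = bessel_I_norm \<alpha> z - bessel_I_norm (\<alpha> + 1) z"
  proof -
    have "z * d = 2 * (of_real \<alpha> + 1) * (bessel_I_norm \<alpha> z - bessel_I_norm (\<alpha> + 1) z)"
      using bessel_I_norm_recurrence[OF assms, of z] by (simp add: d_def)
    moreover have "z / (2 * a) * d = X" if "a \<noteq> 0" "z * d = 2 * a * X" for a X
      using that by simp
    ultimately show ?thesis using nz by blast
  qed
  also have "z / (2 * (of_real \<alpha> + 1)) * bessel_I_norm (\<alpha> + 1) z + (bessel_I_norm \<alpha> z - bessel_I_norm (\<alpha> + 1) z
      + 1 / (2 * (of_real \<alpha> + 1)) * bessel_I_norm (\<alpha> + 1) z) =
      dunkl_E \<alpha> z - of_real ((2 * \<alpha> + 1) / (2 * (\<alpha> + 1))) * bessel_I_norm (\<alpha> + 1) z"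
  proof -
    have "(2 * \<alpha> + 1) / (2 * (\<alpha> + 1)) = 1 - 1 / (2 * (\<alpha> + 1))"
      using assms by (simp add: field_simps)
    then have "of_real ((2 * \<alpha> + 1) / (2 * (\<alpha> + 1))) = 1 - 1 / (2 * (complex_of_real \<alpha> + 1))"
      by simp
    moreover have "P + (I - J + q * J) = I + P - (1 - q) * J" for P I J q :: complex
      by (simp add: algebra_simps)
    ultimately show ?thesis
      unfolding dunkl_E_def by (simp only:)
  qed
  finally show ?thesis .
qed

lemma dunkl_E_holomorphic:
  assumes "\<alpha> > -1"
  shows "(\<lambda>t. dunkl_E \<alpha> (x * t)) holomorphic_on A"
proof -
  have "dunkl_E \<alpha> holomorphic_on UNIV"
    using has_field_derivative_dunkl_E[OF assms]
    by (meson field_differentiable_at_within field_differentiable_def holomorphic_on_def)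
  from holomorphic_on_compose_gen[OF _ this, of "\<lambda>t. x * t" A] show ?thesis
    by (auto simp: o_def intro!: holomorphic_intros)
qed

text \<open>The difference of the values at x and -x is twice the odd part, and the reflection term
  built from it cancels the correction in the ordinary derivative.\<close>

lemma has_dunkl_deriv_dunkl_E:
  assumes "\<alpha> > -1"
  shows "has_dunkl_deriv \<alpha> (\<lambda>x. dunkl_E \<alpha> (t * of_real x)) (\<lambda>x. t * dunkl_E \<alpha> (t * of_real x))"
  unfolding has_dunkl_deriv_def
proof (intro conjI exI[of _ "\<lambda>x. t * (dunkl_E \<alpha> (t * of_real x) -
    of_real ((2 * \<alpha> + 1) / (2 * (\<alpha> + 1))) * bessel_I_norm (\<alpha> + 1) (t * of_real x))"] allI impI)
  have "continuous_on UNIV (dunkl_E \<alpha>)"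
    using has_field_derivative_dunkl_E[OF assms] by (meson DERIV_isCont continuous_at_imp_continuous_on)
  then show "continuous_on UNIV (\<lambda>x::real. t * dunkl_E \<alpha> (t * of_real x))"
    by (intro continuous_on_mult_left continuous_on_compose2[of UNIV "dunkl_E \<alpha>" UNIV "\<lambda>x. t * of_real x"])
       (auto intro!: continuous_intros)
  fix x :: real
  have "((\<lambda>x. t * of_real x) has_vector_derivative t) (at x)"
    using has_vector_derivative_mult_right[OF has_vector_derivative_of_real[OF DERIV_ident], of t] by simp
  from field_vector_diff_chain_at[OF this has_field_derivative_dunkl_E[OF assms]]
  show "((\<lambda>x. dunkl_E \<alpha> (t * complex_of_real x)) has_vector_derivative
          t * (dunkl_E \<alpha> (t * complex_of_real x) - of_real ((2 * \<alpha> + 1) / (2 * (\<alpha> + 1))) * bessel_I_norm (\<alpha> + 1) (t * complex_of_real x)))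
          (at x)" by (simp add: o_def)
  assume "x \<noteq> 0"
  have "dunkl_E \<alpha> (t * of_real x) - dunkl_E \<alpha> (t * of_real (- x)) =
      2 * (t * of_real x / (2 * (of_real \<alpha> + 1)) * bessel_I_norm (\<alpha> + 1) (t * of_real x))"
    by (simp add: dunkl_E_def bessel_I_norm_minus)
  moreover have "p / (2 * X) * (2 * (t * X / (2 * a) * B)) = t * (p / (2 * a)) * B" if "X \<noteq> 0" for p X a B
    using that by simp
  from this[of "of_real x" "of_real (2 * \<alpha> + 1)" "of_real \<alpha> + 1"] \<open>x \<noteq> 0\<close>
  have "of_real ((2 * \<alpha> + 1) / (2 * x)) * (2 * (t * of_real x / (2 * (of_real \<alpha> + 1)) * B))
      = t * of_real ((2 * \<alpha> + 1) / (2 * (\<alpha> + 1))) * B" for B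
    by simp
  ultimately show "t * dunkl_E \<alpha> (t * of_real x) =
      t * (dunkl_E \<alpha> (t * of_real x) -
        of_real ((2 * \<alpha> + 1) / (2 * (\<alpha> + 1))) * bessel_I_norm (\<alpha> + 1) (t * of_real x)) +
      of_real ((2 * \<alpha> + 1) / (2 * x)) * (dunkl_E \<alpha> (t * of_real x) - dunkl_E \<alpha> (t * of_real (- x)))"
    by (simp only: right_diff_distrib mult.assoc diff_add_cancel)
qed

section \<open>The zeros of \<open>\<I>\<^bsub>\<alpha>+1\<^esub>\<close>\<close>

lemma i_times_i_times: "\<i> * (\<i> * x / a * b) = - x / a * b"
proof -
  have "\<i> * (\<i> * x / a * b) = (\<i> * \<i>) * (x / a * b)"
    by (simp only: mult_ac times_divide_eq_left times_divide_eq_right)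
  then show ?thesis by simp
qed

text \<open>For \<alpha> > -1 and x > 0 this is 2^\<alpha> \<Gamma>(\<alpha>+1) x^(-\<alpha>)
  J_\<alpha>(x). Since \<open>bessel_I_norm\<close> is even with real coefficients, it is real on
  the imaginary axis; taking \<open>Re\<close> gives a function to which sign arguments
  apply.\<close>

definition bessel_phi :: "real \<Rightarrow> real \<Rightarrow> real" where
  "bessel_phi \<alpha> x = Re (bessel_I_norm \<alpha> (\<i> * of_real x))"

lemma bessel_I_norm_imaginary:
  assumes "\<alpha> > -1"
  shows "bessel_I_norm \<alpha> (\<i> * of_real x) = of_real (bessel_phi \<alpha> x)"
proof -
  have "cnj (bessel_I_norm \<alpha> (\<i> * of_real x)) = bessel_I_norm \<alpha> (\<i> * of_real x)"
    unfolding cnj_bessel_I_norm[OF assms] by (simp add: bessel_I_norm_minus)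
  then have "bessel_I_norm \<alpha> (\<i> * of_real x) \<in> \<real>"
    by (simp add: complex_is_Real_iff complex_eq_iff)
  then show ?thesis by (simp add: bessel_phi_def of_real_Re)
qed

lemma bessel_phi_0: "\<alpha> > -1 \<Longrightarrow> bessel_phi \<alpha> 0 = 1"
  by (simp add: bessel_phi_def bessel_I_norm_0)

lemma bessel_phi_minus: "bessel_phi \<alpha> (- x) = bessel_phi \<alpha> x"
  by (simp add: bessel_phi_def bessel_I_norm_minus)

lemma has_real_derivative_bessel_phi:
  assumes "\<alpha> > -1"
  shows "(bessel_phi \<alpha> has_real_derivative - x / (2 * (\<alpha> + 1)) * bessel_phi (\<alpha> + 1) x) (at x)"
proof -
  have "((\<lambda>x. \<i> * complex_of_real x) has_vector_derivative \<i>) (at x)"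
    using has_vector_derivative_mult_right[OF has_vector_derivative_of_real[OF DERIV_ident], of \<i>] by simp
  from field_vector_diff_chain_at[OF this has_field_derivative_bessel_I_norm[OF assms]]
  have "((\<lambda>x. bessel_I_norm \<alpha> (\<i> * of_real x)) has_vector_derivative
      \<i> * (\<i> * of_real x / (2 * (of_real \<alpha> + 1)) * bessel_I_norm (\<alpha> + 1) (\<i> * of_real x))) (at x)"
    by (simp add: o_def)
  moreover have "\<i> * (\<i> * of_real x / (2 * (of_real \<alpha> + 1)) * of_real J) =
      complex_of_real (- x / (2 * (\<alpha> + 1)) * J)" for J
    unfolding i_times_i_times by simp
  ultimately have "((\<lambda>x. complex_of_real (bessel_phi \<alpha> x)) has_vector_derivative
      complex_of_real (- x / (2 * (\<alpha> + 1)) * bessel_phi (\<alpha> + 1) x)) (at x)"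
    using assms by (simp only: bessel_I_norm_imaginary)
  then have "((\<lambda>x. Re (complex_of_real (bessel_phi \<alpha> x))) has_vector_derivative
      Re (complex_of_real (- x / (2 * (\<alpha> + 1)) * bessel_phi (\<alpha> + 1) x))) (at x)"
    by (rule bounded_linear.has_vector_derivative[OF bounded_linear_Re])
  then show ?thesis by (simp only: Re_complex_of_real has_real_derivative_iff_has_vector_derivative)
qed

text \<open>The recurrence trades the parameter \<alpha> + 2 for \<alpha>, so that at a zero of
  \<open>bessel_phi (\<alpha> + 1)\<close> only the value of \<open>bessel_phi \<alpha>\<close>
  remains.\<close>

lemma has_real_derivative_bessel_phi_Suc:
  assumes "\<alpha> > -1" "x \<noteq> 0"
  shows "(bessel_phi (\<alpha> + 1) has_real_derivative
     2 * (\<alpha> + 1) / x * (bessel_phi \<alpha> x - bessel_phi (\<alpha> + 1) x)) (at x)"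
proof -
  have "\<i> * of_real x * (\<i> * of_real x / (2 * (of_real (\<alpha> + 1) + 1)) * of_real (bessel_phi (\<alpha> + 1 + 1) x)) =
      2 * (of_real \<alpha> + 1) * (of_real (bessel_phi \<alpha> x) - of_real (bessel_phi (\<alpha> + 1) x))"
    using bessel_I_norm_recurrence[OF assms(1), of "\<i> * of_real x"] assms
    by (simp add: bessel_I_norm_imaginary)
  moreover have "\<i> * X * (\<i> * X / A * J) = X * (- X / A * J)" for X A J
    unfolding i_times_i_times [symmetric] by (simp only: mult_ac)
  ultimately have "complex_of_real (x * (- x / (2 * (\<alpha> + 1 + 1)) * bessel_phi (\<alpha> + 1 + 1) x)) =
      of_real (2 * (\<alpha> + 1) * (bessel_phi \<alpha> x - bessel_phi (\<alpha> + 1) x))"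
    by (simp only: of_real_mult of_real_divide of_real_minus of_real_add of_real_diff of_real_1 of_real_numeral)
  then have "x * (- x / (2 * (\<alpha> + 1 + 1)) * bessel_phi (\<alpha> + 1 + 1) x) =
      2 * (\<alpha> + 1) * (bessel_phi \<alpha> x - bessel_phi (\<alpha> + 1) x)"
    by (rule of_real_eq_iff[THEN iffD1])
  moreover have "D = A / x * B" if "x * D = A * B" for A B D :: real
    using that assms(2) by (simp add: field_simps)
  ultimately have "- x / (2 * (\<alpha> + 1 + 1)) * bessel_phi (\<alpha> + 1 + 1) x =
      2 * (\<alpha> + 1) / x * (bessel_phi \<alpha> x - bessel_phi (\<alpha> + 1) x)"
    by blast
  then show ?thesis
    using has_real_derivative_bessel_phi[of "\<alpha> + 1" x] assms by simp
qed

lemma isCont_bessel_phi: "\<alpha> > -1 \<Longrightarrow> isCont (bessel_phi \<alpha>) x"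
  using has_real_derivative_bessel_phi DERIV_isCont by blast

text \<open>
  A common zero would be a double zero of the solution \<^term>\<open>bessel_phi \<alpha>\<close> of Bessel's equation;
  it is excluded by the monotonicity of \<open>x\<^sup>N (\<phi>\<^sup>2 + \<phi>'\<^sup>2)\<close> for large \<open>N\<close>.
\<close>

lemma bessel_phi_no_common_zero:
  assumes \<alpha>: "\<alpha> > -1" and x0: "x0 > 0"
    and zero: "bessel_phi (\<alpha> + 1) x0 = 0"
  shows "bessel_phi \<alpha> x0 \<noteq> 0"
proof
  assume zero': "bessel_phi \<alpha> x0 = 0"
  define a where "a = 2 * (\<alpha> + 1)"
  have a: "a > 0" using \<alpha> by (simp add: a_def)
  define \<phi> where "\<phi> = bessel_phi \<alpha>"
  define \<psi> where "\<psi> x = - x / a * bessel_phi (\<alpha> + 1) x" for x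
  have d1: "(\<phi> has_real_derivative \<psi> x) (at x)" for x
    unfolding \<phi>_def \<psi>_def a_def by (rule has_real_derivative_bessel_phi[OF \<alpha>])
  \<comment> \<open>This is Bessel's equation for \<open>\<phi>\<close>, with \<open>\<psi>\<close>
    its derivative and a - 1 = 2\<alpha> + 1.\<close>
  have d2: "(\<psi> has_real_derivative - \<phi> x - (a - 1) / x * \<psi> x) (at x)" if "x > 0" for x
  proof -
    have "(bessel_phi (\<alpha> + 1) has_real_derivative a / x * (\<phi> x - bessel_phi (\<alpha> + 1) x)) (at x)"
      unfolding \<phi>_def a_def using that \<alpha> by (intro has_real_derivative_bessel_phi_Suc) auto
    then have "(\<psi> has_real_derivative - x / a * (a / x * (\<phi> x - bessel_phi (\<alpha> + 1) x)) +
        (- 1 / a) * bessel_phi (\<alpha> + 1) x) (at x)"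
      unfolding \<psi>_def by (intro DERIV_mult' DERIV_cdivide DERIV_minus DERIV_ident)
    also have "- x / a * (a / x * (\<phi> x - bessel_phi (\<alpha> + 1) x)) + (- 1 / a) * bessel_phi (\<alpha> + 1) x
        = - \<phi> x - (a - 1) / x * \<psi> x"
      using that a by (simp add: \<psi>_def field_simps)
    finally show ?thesis .
  qed
  \<comment> \<open>With \<open>N\<close> of this size the growth of x^N outweighs the first-order
    term of the equation, and \<open>H\<close> is nondecreasing.\<close>
  obtain N :: nat where N: "real N \<ge> 2 * \<bar>a - 1\<bar>"
    using real_arch_simple by blast
  define H where "H x = x ^ N * ((\<phi> x)\<^sup>2 + (\<psi> x)\<^sup>2)" for x
  have mono: "H x \<le> H x0" if "0 < x" "x \<le> x0" for x
  proof (rule DERIV_nonneg_imp_nondecreasing[OF that(2)])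
    fix y assume y: "x \<le> y" "y \<le> x0"
    then have y0: "y > 0" using that by simp
    define S where "S = (\<phi> y)\<^sup>2 + (\<psi> y)\<^sup>2"
    have "((\<lambda>x. (\<phi> x)\<^sup>2 + (\<psi> x)\<^sup>2) has_real_derivative
       2 * \<phi> y * \<psi> y + 2 * \<psi> y * (- \<phi> y - (a - 1) / y * \<psi> y)) (at y)"
      by (rule derivative_eq_intros d1 d2[OF y0] refl | simp)+
    then have "(H has_real_derivative y ^ N * (2 * \<phi> y * \<psi> y + 2 * \<psi> y * (- \<phi> y - (a - 1) / y * \<psi> y))
        + (real N * y ^ (N - 1)) * S) (at y)"
      unfolding H_def S_def by (intro DERIV_mult') (auto intro!: derivative_eq_intros)
    moreover have "y ^ N * (2 * \<phi> y * \<psi> y + 2 * \<psi> y * (- \<phi> y - (a - 1) / y * \<psi> y))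
        + (real N * y ^ (N - 1)) * S = (y ^ N / y) * (real N * S - 2 * (a - 1) * (\<psi> y)\<^sup>2)"
    proof -
      have "real N * y ^ (N - 1) = real N * (y ^ N / y)"
        using y0 by (cases N) auto
      then show ?thesis
        using y0 by (simp add: field_simps power2_eq_square)
    qed
    moreover have "(y ^ N / y) * (real N * S - 2 * (a - 1) * (\<psi> y)\<^sup>2) \<ge> 0"
    proof (intro mult_nonneg_nonneg)
      have "2 * (a - 1) \<le> real N"
        using N by (cases "a \<ge> 1") auto
      then have "2 * (a - 1) * (\<psi> y)\<^sup>2 \<le> real N * (\<psi> y)\<^sup>2"
        by (rule mult_right_mono) simp
      also have "\<dots> \<le> real N * S"
        unfolding S_def by (intro mult_left_mono) auto
      finally show "0 \<le> real N * S - 2 * (a - 1) * (\<psi> y)\<^sup>2" by simp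
    qed (use y0 in auto)
    ultimately show "\<exists>d. (H has_real_derivative d) (at y) \<and> 0 \<le> d" by metis
  qed
  \<comment> \<open>\<open>H\<close> is zero at the common zero, hence on all of (0, x0], which
    contradicts the limit 1 of \<open>\<phi>\<close> at 0.\<close>
  have "\<phi> x = 0" if "0 < x" "x \<le> x0" for x
  proof -
    have "H x \<le> 0" using mono[OF that] zero zero' by (simp add: H_def \<phi>_def \<psi>_def)
    then have "(\<phi> x)\<^sup>2 + (\<psi> x)\<^sup>2 \<le> 0"
      using zero_less_power[OF that(1), of N] by (auto simp: H_def mult_le_0_iff)
    then show ?thesis by (simp add: sum_power2_le_zero_iff)
  qed
  then have "\<forall>\<^sub>F x in at_right 0. \<phi> x = 0"
    unfolding eventually_at_right_field using x0 by (intro exI[of _ x0]) auto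
  moreover have "(\<phi> \<longlongrightarrow> 1) (at_right 0)"
    using isCont_bessel_phi[OF \<alpha>, of 0] bessel_phi_0[OF \<alpha>]
    by (simp add: \<phi>_def isCont_def filterlim_at_split)
  ultimately have "((\<lambda>x. 0::real) \<longlongrightarrow> 1) (at_right (0::real))"
    by (rule Lim_transform_eventually[rotated])
  then show False by (simp add: tendsto_const_iff)
qed

text \<open>With a positive derivative \<open>f\<close> would be negative just to the left of
  \<open>b\<close>, and the intermediate value theorem would give a zero between \<open>p\<close>
  and \<open>b\<close>.\<close>

lemma DERIV_sign_at_next_zero:
  fixes f :: "real \<Rightarrow> real"
  assumes cont: "\<And>x. isCont f x"
    and ab: "a \<le> p" "p < b" and nz: "\<And>x. a < x \<Longrightarrow> x < b \<Longrightarrow> f x \<noteq> 0"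
    and p: "f p > 0" and D: "(f has_real_derivative d) (at b)" "d \<noteq> 0" "f b = 0"
  shows "d < 0"
proof (rule ccontr)
  assume "\<not> d < 0"
  then have "d > 0" using D by simp
  from DERIV_pos_inc_left[OF D(1) this]
  obtain \<delta> where \<delta>: "\<delta> > 0" "\<And>h. 0 < h \<Longrightarrow> h < \<delta> \<Longrightarrow> f (b - h) < f b" by auto
  define h where "h = min (\<delta> / 2) ((b - p) / 2)"
  have h: "0 < h" "h < \<delta>" "h < b - p" using \<delta>(1) ab by (auto simp: h_def min_def)
  have "f (b - h) < 0" using \<delta>(2)[OF h(1,2)] D(3) by simp
  moreover have "p \<le> b - h" using h by simp
  ultimately obtain x where x: "p \<le> x" "x \<le> b - h" "f x = 0"
    using IVT2[of f "b - h" 0 p] p cont by (auto simp: less_imp_le)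
  with p have "x \<noteq> p" by auto
  with x ab h have "a < x" "x < b" by auto
  from nz[OF this] x show False by simp
qed

lemma bessel_J_eq_0_iff:
  assumes "\<alpha> > -1" "x > 0"
  shows "bessel_J \<alpha> (of_real x) = 0 \<longleftrightarrow> bessel_phi \<alpha> x = 0"
proof -
  \<comment> \<open>The argument -\<i>x is taken because \<i> times it is x, which lies on the
    positive axis inside the principal branch.\<close>
  have "complex_of_real (bessel_phi \<alpha> x) = bessel_I_norm \<alpha> (- (\<i> * of_real x))"
    using assms by (simp add: bessel_I_norm_imaginary bessel_I_norm_minus)
  also have "\<dots> = of_real (2 powr \<alpha> * Gamma (\<alpha> + 1)) * (bessel_J \<alpha> (of_real x) / (of_real x) powr of_real \<alpha>)"
    using assms bessel_I_norm_eq_bessel_J[of "- (\<i> * of_real x)" \<alpha>] by (simp flip: mult.assoc)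
  finally have *: "complex_of_real (bessel_phi \<alpha> x) =
    of_real (2 powr \<alpha> * Gamma (\<alpha> + 1)) * (bessel_J \<alpha> (of_real x) / (of_real x) powr of_real \<alpha>)" .
  have "Gamma (\<alpha> + 1) > 0" using assms by (intro Gamma_real_pos) auto
  then have "bessel_phi \<alpha> x = 0 \<longleftrightarrow>
     of_real (2 powr \<alpha> * Gamma (\<alpha> + 1)) * (bessel_J \<alpha> (of_real x) / (of_real x) powr of_real \<alpha>) = 0"
    unfolding * [symmetric] by simp
  then show ?thesis using \<open>Gamma (\<alpha> + 1) > 0\<close> assms by simp
qed

text \<open>The weight is positive on (0,1), and \<open>f\<close> has no zero on some interval to
  the right of 0. The lemma makes an eigenfunction, whose value at 0 is 1, a nonzero vector.\<close>

lemma norm_L2_dunkl_pos: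
  assumes \<alpha>: "\<alpha> > -1" and f: "continuous_on UNIV f" and f0: "f 0 \<noteq> 0"
  shows "norm_L2 (dunkl_measure \<alpha>) f > 0"
proof (rule ccontr)
  assume "\<not> norm_L2 (dunkl_measure \<alpha>) f > 0"
  then have "norm_L2 (dunkl_measure \<alpha>) f = 0"
    using norm_L2_nonneg[of "dunkl_measure \<alpha>" f] by linarith
  then have "(\<integral>x. (cmod (f x))\<^sup>2 \<partial>dunkl_measure \<alpha>) = 0"
    by (simp add: norm_L2_def)
  moreover have cont: "continuous_on A (\<lambda>x. (cmod (f x))\<^sup>2)" for A
    using f by (intro continuous_intros) (auto intro: continuous_on_subset)
  ultimately have "(\<integral>x. (indicator {-1..1} x * dunkl_weight \<alpha> x) *\<^sub>R (cmod (f x))\<^sup>2 \<partial>lborel) = 0"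
    using integral_dunkl_measure(3)[OF \<alpha> cont] by simp
  then have AE: "AE x in lborel. (indicator {-1..1} x * dunkl_weight \<alpha> x) *\<^sub>R (cmod (f x))\<^sup>2 = 0"
    using integral_dunkl_measure(2)[OF \<alpha> cont] dunkl_weight_nonneg[OF \<alpha>]
    by (subst (asm) integral_nonneg_eq_0_iff_AE) auto
  have "isCont f 0"
    using f by (simp add: continuous_on_eq_continuous_at)
  then obtain \<delta> where \<delta>: "\<delta> > 0" "\<And>x. \<bar>x\<bar> < \<delta> \<Longrightarrow> f x \<noteq> 0"
    using continuous_at_avoid[of 0 f 0] f0 by (auto simp: dist_real_def)
  from AE have "AE x in lborel. x \<notin> {0<..<min 1 \<delta>}"
  proof eventually_elim
    case (elim x)
    show ?case
    proof
      assume x: "x \<in> {0<..<min 1 \<delta>}"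
      then have "dunkl_weight \<alpha> x > 0"
        using \<alpha> by (auto simp: dunkl_weight_def intro!: divide_pos_pos mult_pos_pos Gamma_real_pos)
      with x elim \<delta>(2)[of x] show False by (auto simp: indicator_def)
    qed
  qed
  then have "emeasure lborel {0<..<min 1 \<delta>} = 0"
    by (subst (asm) AE_iff_measurable[where N = "{0<..<min 1 \<delta>}"]) auto
  then show False using \<delta>(1) by (simp add: min_def split: if_splits)
qed

text \<open>
  A zero \<open>z\<close> makes \<open>E\<^sub>\<alpha> (z x)\<close> an eigenfunction of an antisymmetric operator, with eigenvalue \<open>z\<close>.
\<close>

lemma bessel_I_norm_zero_imaginary:
  assumes \<alpha>: "\<alpha> > -1" and z: "bessel_I_norm (\<alpha> + 1) z = 0"
  shows "Re z = 0"
proof -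
  let ?e = "\<lambda>x. dunkl_E \<alpha> (z * of_real x)"
  note E = has_dunkl_deriv_dunkl_E[OF \<alpha>, of z]
  have "dunkl_inner \<alpha> (\<lambda>x. z * ?e x) ?e = - dunkl_inner \<alpha> ?e (\<lambda>x. z * ?e x)"
    using z by (intro dunkl_inner_antisym[OF \<alpha> E E]) (simp_all add: dunkl_E_minus)
  also have "dunkl_inner \<alpha> ?e (\<lambda>x. z * ?e x) = cnj z * dunkl_inner \<alpha> ?e ?e"
    by (subst dunkl_inner_commute) (simp add: dunkl_inner_cmult_left dunkl_inner_self)
  finally have "(z + cnj z) * dunkl_inner \<alpha> ?e ?e = 0"
    by (simp add: dunkl_inner_cmult_left algebra_simps)
  moreover have "norm_L2 (dunkl_measure \<alpha>) ?e > 0"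
    using has_dunkl_deriv_continuous(1)[OF E] by (intro norm_L2_dunkl_pos \<alpha>) (simp_all add: dunkl_E_0 \<alpha>)
  ultimately have "z + cnj z = 0"
    by (simp add: dunkl_inner_self)
  then show ?thesis by (simp add: complex_eq_iff)
qed

section \<open>Enumeration of the zeros, and the signs of \<open>bessel_I_norm \<alpha>\<close>
  there\<close>

locale bessel_zeros =
  fixes \<alpha> :: real and s :: "int \<Rightarrow> real"
  assumes \<alpha>: "\<alpha> > -1" and zeros: "is_bessel_zeros \<alpha> s"
begin

lemma s_minus: "s (- j) = - s j" and s_0 [simp]: "s 0 = 0"
  using zeros by (auto simp: is_bessel_zeros_def)

lemma s_image: "s ` {1..} = {x. x > 0 \<and> bessel_phi (\<alpha> + 1) x = 0}"
proof -
  have "s ` {1..} = {x. x > 0 \<and> bessel_J (\<alpha> + 1) (of_real x) = 0}"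
    using zeros by (simp add: is_bessel_zeros_def)
  also have "\<dots> = {x. x > 0 \<and> bessel_phi (\<alpha> + 1) x = 0}"
    using \<alpha> by (auto simp: bessel_J_eq_0_iff)
  finally show ?thesis .
qed

lemma s_pos: "j \<ge> 1 \<Longrightarrow> s j > 0"
  using s_image by auto

lemma strict_mono_s: "strict_mono s"
proof (rule strict_monoI)
  have pos: "s i < s j" if "1 \<le> i" "i < j" for i j
    using zeros that by (auto simp: is_bessel_zeros_def intro: strict_mono_onD)
  fix i j :: int assume "i < j"
  then consider "1 \<le> i" | "i = 0" "1 \<le> j" | "i \<le> -1" "1 \<le> j" | "i \<le> -1" "j = 0" | "j \<le> -1" by linarith
  then show "s i < s j"
  proof cases
    case 3
    then show ?thesis using s_pos[of "- i"] s_pos[of j] s_minus[of i] by simp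
  next
    case 4
    then show ?thesis using s_pos[of "- i"] s_minus[of i] by simp
  next
    case 5
    then show ?thesis using pos[of "- j" "- i"] \<open>i < j\<close> by (simp add: s_minus)
  qed (use pos s_pos \<open>i < j\<close> in auto)
qed

lemma s_neq_0: "j \<noteq> 0 \<Longrightarrow> s j \<noteq> 0"
  using strict_mono_eq[OF strict_mono_s, of j 0] by simp

lemma bessel_phi_s: "j \<noteq> 0 \<Longrightarrow> bessel_phi (\<alpha> + 1) (s j) = 0"
proof -
  assume "j \<noteq> 0"
  have "bessel_phi (\<alpha> + 1) (s i) = 0" if "i \<ge> 1" for i
    using s_image that by auto
  from this[of j] this[of "- j"] show ?thesis
    using \<open>j \<noteq> 0\<close> by (cases "j \<ge> 1") (auto simp: s_minus bessel_phi_minus)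
qed

text \<open>For nonzero \<open>j\<close> these are the zeros of the denominator of the generating
  function and at the same time eigenvalues of the Dunkl operator. Index 0 gives the origin, where
  the denominator is 1.\<close>

definition pole :: "int \<Rightarrow> complex" where
  "pole j = \<i> * of_real (s j)"

lemma pole_neq_0: "j \<noteq> 0 \<Longrightarrow> pole j \<noteq> 0"
  by (simp add: pole_def s_neq_0)

lemma pole_eq_iff: "pole i = pole j \<longleftrightarrow> i = j"
  by (simp add: pole_def strict_mono_eq[OF strict_mono_s])

lemma cnj_pole: "cnj (pole j) = - pole j"
  by (simp add: pole_def)

lemma norm_pole: "norm (pole j) = s \<bar>j\<bar>"
proof -
  have "\<bar>s j\<bar> = s \<bar>j\<bar>"
    using s_pos[of j] s_pos[of "- j"] s_minus[of j] by (cases j "0::int" rule: linorder_cases) auto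
  then show ?thesis by (simp add: pole_def norm_mult)
qed

text \<open>Antisymmetry places every zero on the imaginary axis; there evenness and the hypothesis
  on \<open>s\<close> identify it.\<close>

lemma bessel_I_norm_zero_iff: "bessel_I_norm (\<alpha> + 1) z = 0 \<longleftrightarrow> (\<exists>j. j \<noteq> 0 \<and> z = pole j)"
proof
  assume z: "bessel_I_norm (\<alpha> + 1) z = 0"
  then have "Re z = 0" by (rule bessel_I_norm_zero_imaginary[OF \<alpha>])
  then have eq: "z = \<i> * of_real (Im z)" by (simp add: complex_eq_iff)
  have "Im z \<noteq> 0"
    using z eq \<alpha> bessel_I_norm_0[of "\<alpha> + 1"] by auto
  moreover have "bessel_phi (\<alpha> + 1) (Im z) = 0"
    using z \<alpha> bessel_I_norm_imaginary[of "\<alpha> + 1" "Im z"] eq by simp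
  ultimately have "\<bar>Im z\<bar> \<in> s ` {1..}"
    unfolding s_image by (auto simp: abs_if bessel_phi_minus)
  then obtain j where j: "j \<ge> 1" "\<bar>Im z\<bar> = s j" by auto
  then have "Im z = s j \<or> Im z = s (- j)" by (auto simp: s_minus abs_if split: if_splits)
  then have "z = pole j \<or> z = pole (- j)" using eq by (auto simp: pole_def)
  with j show "\<exists>j. j \<noteq> 0 \<and> z = pole j" by (metis neg_0_equal_iff_equal not_one_le_zero)
next
  assume "\<exists>j. j \<noteq> 0 \<and> z = pole j"
  then show "bessel_I_norm (\<alpha> + 1) z = 0"
    using \<alpha> by (auto simp: pole_def bessel_I_norm_imaginary bessel_phi_s)
qed

text \<open>
  At a positive zero of \<open>\<phi>\<^bsub>\<alpha>+1\<^esub>\<close> its derivative is a positive multiple of \<open>\<phi>\<^sub>\<alpha>\<close>, and the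
  derivatives at consecutive simple zeros have opposite signs.
\<close>

lemma bessel_phi_s_sign: "(-1) ^ n * bessel_phi \<alpha> (s (int n)) > 0"
proof (induction n)
  case 0
  show ?case by (simp add: bessel_phi_0 \<alpha>)
next
  case (Suc n)
  define j where "j = int n"
  define \<sigma> :: real where "\<sigma> = (-1) ^ n"
  let ?f = "\<lambda>x. \<sigma> * bessel_phi (\<alpha> + 1) x"
  have j: "j \<ge> 0" by (simp add: j_def)
  have less: "s j < s (j + 1)" using strict_mono_s by (simp add: strict_mono_def)
  have cont: "isCont ?f x" for x
    using \<alpha> by (intro continuous_intros isCont_bessel_phi) auto
  have nz: "?f x \<noteq> 0" if "s j < x" "x < s (j + 1)" for x
  proof
    assume "?f x = 0"
    then have "bessel_phi (\<alpha> + 1) x = 0" by (simp add: \<sigma>_def)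
    moreover have "s j \<ge> 0" using j strict_mono_less_eq[OF strict_mono_s, of 0 j] by simp
    ultimately have "x \<in> s ` {1..}" unfolding s_image using that by auto
    then obtain k where "x = s k" by auto
    then show False using that by (auto simp: strict_mono_less[OF strict_mono_s])
  qed
  have deriv: "(?f has_real_derivative 2 * (\<alpha> + 1) / s i * (\<sigma> * bessel_phi \<alpha> (s i))) (at (s i))"
    if "i \<noteq> 0" for i
    using DERIV_cmult[OF has_real_derivative_bessel_phi_Suc[OF \<alpha> s_neq_0[OF that]], of \<sigma>] bessel_phi_s[OF that]
    by (simp add: mult_ac)
  \<comment> \<open>For j = 0 the origin serves, where \<open>bessel_phi (\<alpha> + 1)\<close> is
    1. Otherwise the induction hypothesis makes the derivative at \<open>s j\<close> positive, and
    points just to the right serve.\<close>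
  have "\<exists>p. s j \<le> p \<and> p < s (j + 1) \<and> ?f p > 0"
  proof (cases "j = 0")
    case True
    then show ?thesis using less \<alpha> by (intro exI[of _ 0]) (simp add: bessel_phi_0 \<sigma>_def j_def)
  next
    case False
    with j have "s j > 0" using s_pos by simp
    then have "2 * (\<alpha> + 1) / s j * (\<sigma> * bessel_phi \<alpha> (s j)) > 0"
      using Suc.IH \<alpha> by (intro mult_pos_pos[OF divide_pos_pos]) (auto simp: \<sigma>_def j_def)
    from DERIV_pos_inc_right[OF deriv[OF False] this]
    obtain \<delta> where \<delta>: "\<delta> > 0" "\<And>h. 0 < h \<Longrightarrow> h < \<delta> \<Longrightarrow> ?f (s j) < ?f (s j + h)" by auto
    define h where "h = min (\<delta> / 2) ((s (j + 1) - s j) / 2)"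
    have h: "0 < h" "h < \<delta>" "h < s (j + 1) - s j" using \<delta>(1) less by (auto simp: h_def min_def)
    have "?f (s j + h) > 0" using \<delta>(2)[OF h(1,2)] bessel_phi_s[OF False] by simp
    with h show ?thesis by (intro exI[of _ "s j + h"]) auto
  qed
  then obtain p where p: "s j \<le> p" "p < s (j + 1)" "?f p > 0" by blast
  have j1: "j + 1 \<noteq> 0" "s (j + 1) > 0" using j s_pos[of "j + 1"] by auto
  \<comment> \<open>Without common zeros the zero at \<open>s (j + 1)\<close> is simple, so the
    derivative there has a strict sign.\<close>
  have "bessel_phi \<alpha> (s (j + 1)) \<noteq> 0"
    using bessel_phi_no_common_zero[OF \<alpha> j1(2) bessel_phi_s[OF j1(1)]] .
  then have "2 * (\<alpha> + 1) / s (j + 1) * (\<sigma> * bessel_phi \<alpha> (s (j + 1))) < 0"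
    using p nz j1 \<alpha> bessel_phi_s[OF j1(1)]
    by (intro DERIV_sign_at_next_zero[OF cont p(1,2) nz p(3) deriv[OF j1(1)]]) (auto simp: \<sigma>_def)
  then have "\<sigma> * bessel_phi \<alpha> (s (j + 1)) < 0"
    using j1 \<alpha> by (simp add: mult_less_0_iff zero_less_mult_iff zero_less_divide_iff divide_less_0_iff)
  then show ?case by (simp add: \<sigma>_def j_def add.commute)
qed

text \<open>This is the origin of the factor (-1)^j in the theorem: it turns the modulus in the
  normalisation of \<open>fourier_dunkl\<close> into the value itself. Negative indices follow by
  evenness.\<close>

lemma bessel_I_norm_pole: "bessel_I_norm \<alpha> (pole j) = (-1) powi j * of_real (cmod (bessel_I_norm \<alpha> (pole j)))"
  and bessel_I_norm_pole_neq_0: "bessel_I_norm \<alpha> (pole j) \<noteq> 0"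
proof -
  define n where "n = nat \<bar>j\<bar>"
  have eq: "bessel_I_norm \<alpha> (pole j) = of_real (bessel_phi \<alpha> (s (int n)))"
    unfolding pole_def n_def using \<alpha>
    by (cases "j \<ge> 0") (auto simp: bessel_I_norm_imaginary s_minus bessel_phi_minus)
  have "(-1 :: complex) powi j = (-1) ^ n"
    by (cases "j \<ge> 0") (auto simp: power_int_def n_def)
  moreover have "\<bar>bessel_phi \<alpha> (s (int n))\<bar> = (-1) ^ n * bessel_phi \<alpha> (s (int n))"
    using bessel_phi_s_sign[of n] by (cases "even n") (auto simp: abs_if)
  moreover have "(-1) ^ n * ((-1) ^ n * x) = x" for x :: complex
    by (cases "even n") auto
  ultimately show "bessel_I_norm \<alpha> (pole j) = (-1) powi j * of_real (cmod (bessel_I_norm \<alpha> (pole j)))"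
    unfolding eq by simp
  show "bessel_I_norm \<alpha> (pole j) \<noteq> 0"
    unfolding eq using bessel_phi_s_sign[of n] by auto
qed

text \<open>An entire function with value 1 at the origin and 0 at \<open>pole 1\<close> is not
  constant, so its zeros are isolated.\<close>

lemma finite_zeros: "finite {z \<in> cball 0 B. bessel_I_norm (\<alpha> + 1) z = 0}"
proof -
  have "\<not> bessel_I_norm (\<alpha> + 1) constant_on UNIV"
  proof
    assume "bessel_I_norm (\<alpha> + 1) constant_on UNIV"
    then have "bessel_I_norm (\<alpha> + 1) 0 = bessel_I_norm (\<alpha> + 1) (pole 1)"
      unfolding constant_on_def by fastforce
    moreover have "bessel_I_norm (\<alpha> + 1) (pole 1) = 0"
      unfolding bessel_I_norm_zero_iff by (rule exI[of _ 1]) simp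
    ultimately show False using \<alpha> bessel_I_norm_0[of "\<alpha> + 1"] by simp
  qed
  then show ?thesis
    using \<alpha> by (intro holomorphic_compact_finite_zeros[where S = UNIV] bessel_I_norm_holomorphic) auto
qed

text \<open>A bound would put infinitely many distinct zeros into one closed disc.\<close>

lemma s_unbounded: "\<exists>n. s (int n) > B"
proof (rule ccontr)
  assume "\<not> ?thesis"
  then have B: "s (int n) \<le> B" for n by (auto simp: not_less)
  note finite_zeros[of B]
  moreover have "(\<lambda>n. pole (int (Suc n))) ` UNIV \<subseteq> {z \<in> cball 0 B. bessel_I_norm (\<alpha> + 1) z = 0}"
    using B[of "Suc _"] by (auto simp: norm_pole bessel_I_norm_zero_iff intro!: exI[of _ "int (Suc _)"])
  moreover have "inj (\<lambda>n. pole (int (Suc n)))"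
    by (auto simp: inj_on_def pole_eq_iff)
  ultimately show False
    using finite_subset finite_imageD infinite_UNIV_nat by blast
qed

end

section \<open>Decay estimates and the generating function\<close>

lemma norm_L2_le_bound:
  assumes \<alpha>: "\<alpha> > -1" and f: "continuous_on UNIV f" and B: "\<And>x. x \<in> {-1..1} \<Longrightarrow> cmod (f x) \<le> B"
  shows "norm_L2 (dunkl_measure \<alpha>) f \<le> B * norm_L2 (dunkl_measure \<alpha>) (\<lambda>_. 1)"
proof -
  have "cmod (f 0) \<le> B" by (rule B) simp
  then have B0: "B \<ge> 0" by (rule order_trans[OF norm_ge_zero])
  have "(\<integral>x. (cmod (f x))\<^sup>2 \<partial>dunkl_measure \<alpha>) \<le> (\<integral>x. (cmod (of_real B * 1))\<^sup>2 \<partial>dunkl_measure \<alpha>)"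
  proof (rule integral_mono)
    show "integrable (dunkl_measure \<alpha>) (\<lambda>x. (cmod (f x))\<^sup>2)"
      using square_integrable_dunkl_measure[OF \<alpha> f] by (simp add: square_integrable_def)
    show "integrable (dunkl_measure \<alpha>) (\<lambda>x. (cmod (of_real B * 1))\<^sup>2)"
      using \<alpha> by (intro integral_dunkl_measure(1)) auto
    show "(cmod (f x))\<^sup>2 \<le> (cmod (of_real B * 1))\<^sup>2" if "x \<in> space (dunkl_measure \<alpha>)" for x
      using B[of x] B0 that by (auto intro: power_mono)
  qed
  then have "norm_L2 (dunkl_measure \<alpha>) f \<le> norm_L2 (dunkl_measure \<alpha>) (\<lambda>_. of_real B * 1)"
    unfolding norm_L2_def by (rule real_sqrt_le_mono)
  then show ?thesis unfolding norm_L2_cmult using B0 by simp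
qed

text \<open>Dominated convergence: |x| < 1 almost everywhere on the interval, and the weight itself
  is the integrable bound.\<close>

lemma norm_L2_monomial_tendsto_0:
  assumes \<alpha>: "\<alpha> > -1"
  shows "(\<lambda>m. norm_L2 (dunkl_measure \<alpha>) (\<lambda>x. of_real x ^ m)) \<longlonglongrightarrow> 0"
proof -
  let ?w = "\<lambda>x. indicator {-1..1} x * dunkl_weight \<alpha> x"
  have cont: "continuous_on {-1..1} (\<lambda>x. (cmod (of_real x ^ m))\<^sup>2)" for m
    by (intro continuous_intros)
  have "(\<lambda>m. \<integral>x. ?w x *\<^sub>R (cmod (of_real x ^ m))\<^sup>2 \<partial>lborel) \<longlonglongrightarrow> integral\<^sup>L lborel (\<lambda>x::real. 0::real)"
  proof (rule integral_dominated_convergence[where w = ?w])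
    show "integrable lborel ?w" by (rule lborel_integrable_dunkl_weight[OF \<alpha>])
    have "AE x in lborel. x \<noteq> 1 \<and> x \<noteq> (-1::real)"
      using AE_lborel_singleton by (auto intro!: AE_conjI)
    then show "AE x in lborel. (\<lambda>m. ?w x *\<^sub>R (cmod (of_real x ^ m))\<^sup>2) \<longlonglongrightarrow> 0"
    proof eventually_elim
      case (elim x)
      show ?case
      proof (cases "x \<in> {-1..1}")
        case True
        with elim have "\<bar>x\<bar> < 1" by auto
        then have "(\<lambda>m. (\<bar>x\<bar> ^ m)\<^sup>2) \<longlonglongrightarrow> 0\<^sup>2"
          by (intro tendsto_power LIMSEQ_realpow_zero) auto
        then have "(\<lambda>m. ?w x * (\<bar>x\<bar> ^ m)\<^sup>2) \<longlonglongrightarrow> ?w x * 0"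
          by (intro tendsto_mult_left) simp
        then show ?thesis by (simp add: norm_power)
      qed simp
    qed
    fix m :: nat
    show "AE x in lborel. norm (?w x *\<^sub>R (cmod (of_real x ^ m))\<^sup>2) \<le> ?w x"
    proof (rule AE_I2)
      fix x :: real
      show "norm (?w x *\<^sub>R (cmod (of_real x ^ m))\<^sup>2) \<le> ?w x"
      proof (cases "x \<in> {-1..1}")
        case True
        then have "(\<bar>x\<bar> ^ m)\<^sup>2 \<le> 1" by (intro power_le_one) auto
        then show ?thesis using True dunkl_weight_nonneg[OF \<alpha>, of x]
          by (simp add: norm_power mult_left_le)
      qed simp
    qed
  qed (use integral_dunkl_measure(2)[OF \<alpha> cont] lborel_integrable_dunkl_weight[OF \<alpha>] in
        \<open>auto dest: borel_measurable_integrable\<close>)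
  then have "(\<lambda>m. \<integral>x. (cmod (of_real x ^ m))\<^sup>2 \<partial>dunkl_measure \<alpha>) \<longlonglongrightarrow> 0"
    unfolding integral_dunkl_measure(3)[OF \<alpha> cont] by simp
  then have "(\<lambda>m. sqrt (\<integral>x. (cmod (of_real x ^ m))\<^sup>2 \<partial>dunkl_measure \<alpha>)) \<longlonglongrightarrow> sqrt 0"
    by (rule tendsto_real_sqrt)
  then show ?thesis by (simp add: norm_L2_def)
qed

text \<open>Log-convexity makes the ratios of consecutive terms nondecreasing. If one ratio exceeded
  \<open>q\<close>, so would all later ones, and the sequence would outgrow the bound.\<close>

lemma log_convex_geometric_decay:
  fixes a :: "nat \<Rightarrow> real"
  assumes nonneg: "\<And>n. a n \<ge> 0" and conv: "\<And>n. (a (Suc n))\<^sup>2 \<le> a n * a (Suc (Suc n))"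
    and bound: "\<And>n. a n \<le> K * q ^ n" and q: "q > 0"
  shows "a (Suc n) \<le> q * a n"
proof (rule ccontr)
  assume "\<not> a (Suc n) \<le> q * a n"
  then have gt: "a (Suc n) > q * a n" by simp
  have "q * a n \<ge> 0" using q nonneg by simp
  with gt have S: "a (Suc n) > 0" by linarith
  have an: "a n > 0"
  proof (rule ccontr)
    assume "\<not> a n > 0"
    with nonneg[of n] have "a n = 0" by simp
    with conv[of n] S show False by simp
  qed
  define r where "r = a (Suc n) / a n"
  have r: "r > q" using gt an by (simp add: r_def field_simps)
  have step: "a (n + m) > 0 \<and> a (Suc (n + m)) \<ge> r * a (n + m)" for m
  proof (induction m)
    case 0
    then show ?case using an by (simp add: r_def)
  next
    case (Suc m)
    then have A: "a (n + m) > 0" "a (Suc (n + m)) \<ge> r * a (n + m)" by auto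
    have "r * a (n + m) > 0" using A r q by (intro mult_pos_pos) auto
    then have B: "a (Suc (n + m)) > 0" using A by linarith
    have "(r * a (n + m)) * a (Suc (n + m)) \<le> a (Suc (n + m)) * a (Suc (n + m))"
      using A B by (intro mult_right_mono) auto
    also have "\<dots> \<le> a (n + m) * a (Suc (Suc (n + m)))"
      using conv[of "n + m"] by (simp add: power2_eq_square)
    finally have "a (n + m) * (r * a (Suc (n + m))) \<le> a (n + m) * a (Suc (Suc (n + m)))"
      by (simp add: mult_ac)
    then have "r * a (Suc (n + m)) \<le> a (Suc (Suc (n + m)))"
      using A(1) by (simp add: mult_le_cancel_left)
    then show ?case using B by simp
  qed
  have lower: "a (n + m) \<ge> a n * r ^ m" for m
  proof (induction m)
    case (Suc m)
    have "a n * r ^ Suc m = r * (a n * r ^ m)" by simp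
    also have "\<dots> \<le> r * a (n + m)" using Suc r q by (intro mult_left_mono) auto
    also have "\<dots> \<le> a (n + Suc m)" using step[of m] by simp
    finally show ?case .
  qed simp
  have "(r / q) ^ m \<le> K * q ^ n / a n" for m
  proof -
    have "a n * r ^ m \<le> K * q ^ n * q ^ m"
      using lower[of m] bound[of "n + m"] by (simp add: power_add mult_ac)
    then show ?thesis using an q by (simp add: power_divide field_simps)
  qed
  moreover have "1 < r / q" using r q by simp
  then obtain m where "K * q ^ n / a n < (r / q) ^ m"
    using real_arch_pow by blast
  ultimately show False by (meson not_less)
qed

lemma has_dunkl_deriv_monomial:
  assumes \<alpha>: "\<alpha> > -1"
  shows "has_dunkl_deriv \<alpha> (\<lambda>x. of_real x ^ Suc n / of_real (dunkl_gamma (Suc n) \<alpha>))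
           (\<lambda>x. of_real x ^ n / of_real (dunkl_gamma n \<alpha>))"
  unfolding has_dunkl_deriv_def
proof (intro conjI exI[of _ "\<lambda>x. of_real (real (Suc n) * x ^ n / dunkl_gamma (Suc n) \<alpha>)"] allI impI)
  show "continuous_on UNIV (\<lambda>x. complex_of_real x ^ n / of_real (dunkl_gamma n \<alpha>))"
    using dunkl_gamma_pos[OF \<alpha>, of n] by (intro continuous_intros) auto
  fix x :: real
  have "((\<lambda>x. x ^ Suc n / dunkl_gamma (Suc n) \<alpha>) has_real_derivative
     real (Suc n) * x ^ n / dunkl_gamma (Suc n) \<alpha>) (at x)"
    using DERIV_cdivide[OF DERIV_pow[of "Suc n" x]] by simp
  from has_vector_derivative_of_real[OF this, where 'a = complex]
  show "((\<lambda>x. complex_of_real x ^ Suc n / of_real (dunkl_gamma (Suc n) \<alpha>)) has_vector_derivative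
     of_real (real (Suc n) * x ^ n / dunkl_gamma (Suc n) \<alpha>)) (at x)" by simp
  assume x: "x \<noteq> 0"
  define c where "c = (if even n then real n + 2 * \<alpha> + 2 else real n + 1)"
  have g: "dunkl_gamma (Suc n) \<alpha> = c * dunkl_gamma n \<alpha>"
    by (simp add: dunkl_gamma_Suc c_def)
  have pos: "dunkl_gamma n \<alpha> > 0" "dunkl_gamma (Suc n) \<alpha> > 0"
    using \<alpha> by (auto intro: dunkl_gamma_pos)
  have "x ^ n / dunkl_gamma n \<alpha> = c * x ^ n / dunkl_gamma (Suc n) \<alpha>"
    using pos unfolding g by (auto simp: zero_less_mult_iff)
  \<comment> \<open>For even \<open>n\<close> the reflection doubles the odd power x^(n+1) and
    contributes 2\<alpha> + 1; for odd \<open>n\<close> it cancels the even power.\<close>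
  also have "c * x ^ n = real (Suc n) * x ^ n + (2 * \<alpha> + 1) / (2 * x) * (x ^ Suc n - (- x) ^ Suc n)"
    using x by (auto simp: c_def field_simps)
  also have "\<dots> / dunkl_gamma (Suc n) \<alpha> = real (Suc n) * x ^ n / dunkl_gamma (Suc n) \<alpha> +
      (2 * \<alpha> + 1) / (2 * x) * (x ^ Suc n / dunkl_gamma (Suc n) \<alpha> - (- x) ^ Suc n / dunkl_gamma (Suc n) \<alpha>)"
    by (simp only: add_divide_distrib diff_divide_distrib times_divide_eq_right right_diff_distrib)
  finally have "complex_of_real (x ^ n / dunkl_gamma n \<alpha>) = of_real (real (Suc n) * x ^ n / dunkl_gamma (Suc n) \<alpha> +
      (2 * \<alpha> + 1) / (2 * x) * (x ^ Suc n / dunkl_gamma (Suc n) \<alpha> - (- x) ^ Suc n / dunkl_gamma (Suc n) \<alpha>))"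
    by (simp only:)
  then show "complex_of_real x ^ n / of_real (dunkl_gamma n \<alpha>) =
     of_real (real (Suc n) * x ^ n / dunkl_gamma (Suc n) \<alpha>) +
     of_real ((2 * \<alpha> + 1) / (2 * x)) * (of_real x ^ Suc n / of_real (dunkl_gamma (Suc n) \<alpha>) -
       of_real (- x) ^ Suc n / of_real (dunkl_gamma (Suc n) \<alpha>))"
    by (simp only: of_real_add of_real_mult of_real_divide of_real_diff of_real_power)
qed

section \<open>The generating function as a formal power series\<close>

definition bessel_I_fps :: "real \<Rightarrow> complex fps" where
  "bessel_I_fps \<alpha> = Abs_fps (\<lambda>n. if even n then 1 / of_real (dunkl_gamma n \<alpha>) else 0)"

definition dunkl_E_fps :: "real \<Rightarrow> complex \<Rightarrow> complex fps" where
  "dunkl_E_fps \<alpha> x = Abs_fps (\<lambda>n. x ^ n / of_real (dunkl_gamma n \<alpha>))"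

lemma bessel_I_norm_has_fps_expansion:
  assumes "\<alpha> > -1"
  shows "bessel_I_norm \<alpha> has_fps_expansion bessel_I_fps \<alpha>"
proof (rule has_fps_expansionI, rule always_eventually, rule allI)
  fix z
  show "(\<lambda>n. fps_nth (bessel_I_fps \<alpha>) n * z ^ n) sums bessel_I_norm \<alpha> z"
    using bessel_I_norm_sums[OF assms, of z]
    by (subst sums_even_reindex [symmetric]) (simp_all add: bessel_I_fps_def)
qed

lemma dunkl_E_has_fps_expansion:
  assumes "\<alpha> > -1"
  shows "(\<lambda>t. dunkl_E \<alpha> (x * t)) has_fps_expansion dunkl_E_fps \<alpha> x"
proof (rule has_fps_expansionI, rule always_eventually, rule allI)
  fix z
  show "(\<lambda>n. fps_nth (dunkl_E_fps \<alpha> x) n * z ^ n) sums dunkl_E \<alpha> (x * z)"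
    using dunkl_E_sums[OF assms, of "x * z"] by (simp add: dunkl_E_fps_def power_mult_distrib)
qed

text \<open>For fixed \<open>x\<close> this is the generating function as a series in t; the
  denominator has constant coefficient 1 and so is formally invertible.\<close>

definition bernoulli_dunkl_fps :: "real \<Rightarrow> complex \<Rightarrow> complex fps" where
  "bernoulli_dunkl_fps \<alpha> x = dunkl_E_fps \<alpha> x * inverse (bessel_I_fps (\<alpha> + 1))"

lemma bessel_I_fps_nth_0: "fps_nth (bessel_I_fps \<alpha>) 0 = 1"
  by (simp add: bessel_I_fps_def)

lemma generating_function_has_fps_expansion:
  assumes "\<alpha> > -1"
  shows "(\<lambda>t. dunkl_E \<alpha> (x * t) / bessel_I_norm (\<alpha> + 1) t) has_fps_expansion bernoulli_dunkl_fps \<alpha> x"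
  unfolding bernoulli_dunkl_fps_def divide_inverse using assms
  by (intro has_fps_expansion_mult has_fps_expansion_inverse dunkl_E_has_fps_expansion
      bessel_I_norm_has_fps_expansion) (auto simp: bessel_I_fps_nth_0)

lemma bernoulli_dunkl_fps_mult: "bernoulli_dunkl_fps \<alpha> x * bessel_I_fps (\<alpha> + 1) = dunkl_E_fps \<alpha> x"
  by (simp add: bernoulli_dunkl_fps_def mult.assoc inverse_mult_eq_1 bessel_I_fps_nth_0)

text \<open>
  This is the Bernoulli--Dunkl polynomial divided by \<open>\<gamma>\<^bsub>n,\<alpha>\<^esub>\<close>; the Dunkl operator lowers \<open>n\<close> by one.
\<close>

definition bernoulli_coeff :: "real \<Rightarrow> nat \<Rightarrow> real \<Rightarrow> complex" where
  "bernoulli_coeff \<alpha> n x = fps_nth (bernoulli_dunkl_fps \<alpha> (of_real x)) n"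

lemma bernoulli_dunkl_eq:
  assumes "\<alpha> > -1"
  shows "bernoulli_dunkl n \<alpha> (of_real x) = of_real (dunkl_gamma n \<alpha>) * bernoulli_coeff \<alpha> n x"
  unfolding bernoulli_dunkl_def bernoulli_coeff_def
  by (simp add: fps_expansion_eqI[OF generating_function_has_fps_expansion[OF assms]])

lemma bernoulli_coeff_eq_sum:
  "bernoulli_coeff \<alpha> n x = (\<Sum>k=0..n. fps_nth (inverse (bessel_I_fps (\<alpha> + 1))) (n - k) *
     (of_real x ^ k / of_real (dunkl_gamma k \<alpha>)))"
  unfolding bernoulli_coeff_def bernoulli_dunkl_fps_def fps_mult_nth by (rule sum.cong) (simp_all add: dunkl_E_fps_def)

text \<open>By the Cauchy product each coefficient is a combination of the monomials x^k /
  \<gamma>_k, which the Dunkl operator shifts down by one while it kills the constant.\<close>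

lemma has_dunkl_deriv_bernoulli_coeff:
  assumes \<alpha>: "\<alpha> > -1"
  shows "has_dunkl_deriv \<alpha> (bernoulli_coeff \<alpha> (Suc n)) (bernoulli_coeff \<alpha> n)"
proof -
  let ?b = "fps_nth (inverse (bessel_I_fps (\<alpha> + 1)))"
  have "has_dunkl_deriv \<alpha>
     (\<lambda>x. ?b (Suc n) + (\<Sum>k=0..n. ?b (n - k) * (of_real x ^ Suc k / of_real (dunkl_gamma (Suc k) \<alpha>))))
     (\<lambda>x. 0 + (\<Sum>k=0..n. ?b (n - k) * (of_real x ^ k / of_real (dunkl_gamma k \<alpha>))))"
    by (intro has_dunkl_deriv_add has_dunkl_deriv_const has_dunkl_deriv_sum
        has_dunkl_deriv_cmult has_dunkl_deriv_monomial \<alpha>)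
  moreover have "bernoulli_coeff \<alpha> (Suc n) = (\<lambda>x. ?b (Suc n) +
      (\<Sum>k=0..n. ?b (n - k) * (of_real x ^ Suc k / of_real (dunkl_gamma (Suc k) \<alpha>))))"
    unfolding bernoulli_coeff_eq_sum [abs_def] sum.atLeast0_atMost_Suc_shift by simp
  moreover have "bernoulli_coeff \<alpha> n = (\<lambda>x. 0 + (\<Sum>k=0..n. ?b (n - k) * (of_real x ^ k / of_real (dunkl_gamma k \<alpha>))))"
    unfolding bernoulli_coeff_eq_sum [abs_def] by simp
  ultimately show ?thesis by (simp only:)
qed

text \<open>The numerators at x = 1 and x = -1 differ by t/(\<alpha>+1) times the denominator. The
  generating functions therefore differ by t/(\<alpha>+1), and only the coefficient of index 1 takes
  unequal values.\<close>

lemma bernoulli_coeff_periodic: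
  assumes \<alpha>: "\<alpha> > -1" and n: "n \<ge> 2"
  shows "bernoulli_coeff \<alpha> n 1 = bernoulli_coeff \<alpha> n (- 1)"
proof -
  let ?I = "bessel_I_fps (\<alpha> + 1)"
  have "dunkl_E_fps \<alpha> 1 - dunkl_E_fps \<alpha> (- 1) = fps_const (1 / of_real (\<alpha> + 1)) * fps_X * ?I"
  proof (rule fps_ext)
    fix n
    show "fps_nth (dunkl_E_fps \<alpha> 1 - dunkl_E_fps \<alpha> (- 1)) n =
        fps_nth (fps_const (1 / of_real (\<alpha> + 1)) * fps_X * ?I) n"
    proof (cases "even n")
      case True
      then show ?thesis by (cases n) (auto simp: dunkl_E_fps_def bessel_I_fps_def mult.assoc)
    next
      case False
      then obtain k where k: "n = 2 * k + 1" by (elim oddE)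
      have "dunkl_gamma n \<alpha> = 2 * (\<alpha> + 1) * dunkl_gamma (2 * k) (\<alpha> + 1)"
        unfolding k by (rule dunkl_gamma_odd)
      then have "2 / dunkl_gamma n \<alpha> = 1 / (\<alpha> + 1) * (1 / dunkl_gamma (2 * k) (\<alpha> + 1))"
        by (simp only: mult.assoc divide_mult_cancel_left_1[of 2 "(\<alpha> + 1) * _"]) simp
      from arg_cong[OF this, of complex_of_real] show ?thesis
        by (simp add: dunkl_E_fps_def bessel_I_fps_def mult.assoc k)
    qed
  qed
  then have "bernoulli_dunkl_fps \<alpha> 1 - bernoulli_dunkl_fps \<alpha> (- 1) = fps_const (1 / of_real (\<alpha> + 1)) * fps_X * (?I * inverse ?I)"
    unfolding bernoulli_dunkl_fps_def by (simp only: left_diff_distrib [symmetric] mult.assoc)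
  also have "?I * inverse ?I = 1"
    by (simp add: inverse_mult_eq_1' bessel_I_fps_nth_0)
  finally have "fps_nth (bernoulli_dunkl_fps \<alpha> 1 - bernoulli_dunkl_fps \<alpha> (- 1)) n = 0"
    using n by (simp add: fps_X_def)
  then show ?thesis by (simp add: bernoulli_coeff_def)
qed

section \<open>The remainders of the expansion\<close>

context bessel_zeros
begin

definition eigenfun :: "int \<Rightarrow> real \<Rightarrow> complex" where
  "eigenfun j x = dunkl_E \<alpha> (pole j * of_real x)"

text \<open>
  By \<open>t \<I>'\<^bsub>\<alpha>+1\<^esub>(t) = 2(\<alpha>+1) (\<I>\<^sub>\<alpha>(t) - \<I>\<^bsub>\<alpha>+1\<^esub>(t))\<close>, the residue of
  \<open>E\<^sub>\<alpha>(x t) / (\<I>\<^bsub>\<alpha>+1\<^esub>(t) t\<^bsup>n+1\<^esup>)\<close> at the \<open>j\<close>-th pole is this number times the \<open>j\<close>-th eigenfunction.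
\<close>

definition pole_coeff :: "int \<Rightarrow> nat \<Rightarrow> complex" where
  "pole_coeff j n = 1 / (2 * of_real (\<alpha> + 1) * bessel_I_norm \<alpha> (pole j) * pole j ^ n)"

text \<open>The sum enters with a plus sign because the expansion to be proved equates
  \<open>bernoulli_coeff\<close> with minus the sum of the residues at all nonzero indices.\<close>

definition remainder :: "nat \<Rightarrow> int set \<Rightarrow> real \<Rightarrow> complex" where
  "remainder n F x = bernoulli_coeff \<alpha> n x + (\<Sum>j\<in>F. pole_coeff j n * eigenfun j x)"

definition sym_indices :: "nat \<Rightarrow> int set" where
  "sym_indices N = {- int N..int N} - {0}"

abbreviation nrm :: "(real \<Rightarrow> complex) \<Rightarrow> real" where
  "nrm \<equiv> norm_L2 (dunkl_measure \<alpha>)"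

lemma finite_sym_indices [simp]: "finite (sym_indices N)" and zero_notin_sym_indices [simp]: "0 \<notin> sym_indices N"
  by (simp_all add: sym_indices_def)

lemma has_dunkl_deriv_eigenfun: "has_dunkl_deriv \<alpha> (eigenfun j) (\<lambda>x. pole j * eigenfun j x)"
  unfolding eigenfun_def by (rule has_dunkl_deriv_dunkl_E[OF \<alpha>])

lemma eigenfun_periodic:
  assumes "j \<noteq> 0"
  shows "eigenfun j 1 = eigenfun j (- 1)"
proof -
  have "bessel_I_norm (\<alpha> + 1) (pole j) = 0"
    using assms by (auto simp: bessel_I_norm_zero_iff)
  then show ?thesis by (simp add: eigenfun_def dunkl_E_minus)
qed

lemma pole_coeff_Suc: "j \<noteq> 0 \<Longrightarrow> pole_coeff j (Suc n) * pole j = pole_coeff j n"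
  by (simp add: pole_coeff_def pole_neq_0)

lemma has_dunkl_deriv_remainder:
  assumes "0 \<notin> F"
  shows "has_dunkl_deriv \<alpha> (remainder (Suc n) F) (remainder n F)"
proof -
  have "has_dunkl_deriv \<alpha> (remainder (Suc n) F)
     (\<lambda>x. bernoulli_coeff \<alpha> n x + (\<Sum>j\<in>F. pole_coeff j (Suc n) * (pole j * eigenfun j x)))"
    unfolding remainder_def
    by (intro has_dunkl_deriv_add has_dunkl_deriv_sum has_dunkl_deriv_cmult
        has_dunkl_deriv_bernoulli_coeff has_dunkl_deriv_eigenfun \<alpha>)
  also have "(\<lambda>x. bernoulli_coeff \<alpha> n x + (\<Sum>j\<in>F. pole_coeff j (Suc n) * (pole j * eigenfun j x))) = remainder n F"
    unfolding remainder_def mult.assoc [symmetric] using assms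
    by (intro ext arg_cong2[where f = "(+)"] sum.cong refl) (metis pole_coeff_Suc)
  finally show ?thesis .
qed

lemma continuous_eigenfun: "continuous_on A (eigenfun j)"
  using has_dunkl_deriv_continuous(1)[OF has_dunkl_deriv_eigenfun] .

lemma continuous_bernoulli_coeff: "continuous_on A (bernoulli_coeff \<alpha> n)"
  using has_dunkl_deriv_continuous(2)[OF has_dunkl_deriv_bernoulli_coeff[OF \<alpha>]] .

lemma continuous_remainder: "continuous_on A (remainder n F)"
  unfolding remainder_def by (intro continuous_intros continuous_bernoulli_coeff continuous_eigenfun)

lemma remainder_periodic:
  assumes "n \<ge> 2" "0 \<notin> F"
  shows "remainder n F 1 = remainder n F (- 1)"
proof -
  have "(\<Sum>j\<in>F. pole_coeff j n * eigenfun j 1) = (\<Sum>j\<in>F. pole_coeff j n * eigenfun j (- 1))"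
    using assms by (intro sum.cong refl) (metis eigenfun_periodic)
  then show ?thesis using bernoulli_coeff_periodic[OF \<alpha> assms(1)] by (simp add: remainder_def)
qed

text \<open>An antisymmetric operator has orthogonal eigenvectors for distinct imaginary
  eigenvalues; the sign from antisymmetry and the sign from \<open>cnj_pole\<close> cancel.\<close>

lemma dunkl_inner_eigenfun:
  assumes "i \<noteq> 0" "j \<noteq> 0" "i \<noteq> j"
  shows "dunkl_inner \<alpha> (eigenfun i) (eigenfun j) = 0"
proof -
  have "dunkl_inner \<alpha> (\<lambda>x. pole i * eigenfun i x) (eigenfun j) =
      - dunkl_inner \<alpha> (eigenfun i) (\<lambda>x. pole j * eigenfun j x)"
    using assms by (intro dunkl_inner_antisym has_dunkl_deriv_eigenfun \<alpha> eigenfun_periodic)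
  also have "dunkl_inner \<alpha> (eigenfun i) (\<lambda>x. pole j * eigenfun j x) =
      - pole j * dunkl_inner \<alpha> (eigenfun i) (eigenfun j)"
    by (subst dunkl_inner_commute, subst (2) dunkl_inner_commute)
       (simp add: dunkl_inner_cmult_left cnj_pole)
  finally have "(pole i - pole j) * dunkl_inner \<alpha> (eigenfun i) (eigenfun j) = 0"
    by (simp add: dunkl_inner_cmult_left algebra_simps)
  then show ?thesis using assms by (simp add: pole_eq_iff)
qed

text \<open>Antisymmetry is applied to the remainder of index n + 1, which is at least 2, so that
  its values at 1 and -1 agree.\<close>

lemma dunkl_inner_remainder_Suc:
  assumes "0 \<notin> F" "k \<noteq> 0" "n \<ge> 1"
  shows "dunkl_inner \<alpha> (remainder n F) (eigenfun k) = pole k * dunkl_inner \<alpha> (remainder (Suc n) F) (eigenfun k)"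
proof -
  have "dunkl_inner \<alpha> (remainder n F) (eigenfun k) =
      - dunkl_inner \<alpha> (remainder (Suc n) F) (\<lambda>x. pole k * eigenfun k x)"
    using assms by (intro dunkl_inner_antisym has_dunkl_deriv_eigenfun has_dunkl_deriv_remainder
        \<alpha> eigenfun_periodic remainder_periodic) auto
  also have "dunkl_inner \<alpha> (remainder (Suc n) F) (\<lambda>x. pole k * eigenfun k x) =
      - pole k * dunkl_inner \<alpha> (remainder (Suc n) F) (eigenfun k)"
    by (subst dunkl_inner_commute, subst (2) dunkl_inner_commute)
       (simp add: dunkl_inner_cmult_left cnj_pole)
  finally show ?thesis by simp
qed

text \<open>Antisymmetry moves the operator from index n + 2 to index n + 1, so the square of the
  middle norm is minus the inner product of the outer remainders; Cauchy-Schwarz concludes.\<close>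

lemma nrm_remainder_log_convex:
  assumes "0 \<notin> F" "n \<ge> 1"
  shows "(nrm (remainder (Suc n) F))\<^sup>2 \<le> nrm (remainder n F) * nrm (remainder (Suc (Suc n)) F)"
proof -
  have "dunkl_inner \<alpha> (remainder (Suc n) F) (remainder (Suc n) F) =
      - dunkl_inner \<alpha> (remainder (Suc (Suc n)) F) (remainder n F)"
    using assms by (intro dunkl_inner_antisym has_dunkl_deriv_remainder \<alpha> remainder_periodic) auto
  then have "cmod (dunkl_inner \<alpha> (remainder (Suc n) F) (remainder (Suc n) F)) \<le>
      nrm (remainder (Suc (Suc n)) F) * nrm (remainder n F)"
    using dunkl_inner_Cauchy_Schwarz[OF \<alpha> continuous_remainder continuous_remainder] by simp
  then show ?thesis
    by (simp add: dunkl_inner_self norm_power norm_L2_nonneg mult.commute)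
qed

section \<open>Residues and the contour bound\<close>

lemma residue_at_pole:
  assumes j: "j \<noteq> 0"
  shows "residue (\<lambda>t. dunkl_E \<alpha> (of_real x * t) / bessel_I_norm (\<alpha> + 1) t / t ^ Suc n) (pole j) =
     pole_coeff j n * eigenfun j x"
proof -
  let ?I = "bessel_I_norm (\<alpha> + 1)"
  let ?p = "pole j"
  let ?d = "?p / (2 * (of_real (\<alpha> + 1) + 1)) * bessel_I_norm (\<alpha> + 1 + 1) ?p"
  have I0: "?I ?p = 0" using j by (auto simp: bessel_I_norm_zero_iff)
  \<comment> \<open>At a zero of the denominator the recurrence expresses its derivative through
    \<open>bessel_I_norm \<alpha>\<close>, which is nonzero there; the zero is simple.\<close>
  have d: "?d = 2 * of_real (\<alpha> + 1) * bessel_I_norm \<alpha> ?p / ?p"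
    using bessel_I_norm_recurrence[OF \<alpha>, of ?p] I0 pole_neq_0[OF j]
    by (simp add: nonzero_eq_divide_eq mult.commute)
  have "complex_of_real (\<alpha> + 1) \<noteq> 0" using \<alpha> by (subst of_real_eq_0_iff) auto
  then have d0: "2 * of_real (\<alpha> + 1) * bessel_I_norm \<alpha> ?p / ?p \<noteq> 0"
    using bessel_I_norm_pole_neq_0[of j] pole_neq_0[OF j]
    by (metis divide_eq_0_iff mult_eq_0_iff zero_neq_numeral)
  have Ex: "(\<lambda>t. dunkl_E \<alpha> (of_real x * t)) holomorphic_on A" for A
    by (rule dunkl_E_holomorphic[OF \<alpha>])
  \<comment> \<open>A disc around the origin that contains the pole, freed from 0 and from the
    finitely many other zeros.\<close>
  define T where "T = - (insert 0 {z \<in> cball 0 (norm ?p + 1). ?I z = 0} - {?p}) \<inter> ball 0 (norm ?p + 1)"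
  have fin: "finite {z \<in> cball 0 (norm ?p + 1). ?I z = 0}"
    by (rule finite_zeros)
  show ?thesis
  proof (rule residue_simple'[where s = T])
    show "open T"
      unfolding T_def using fin by (intro open_Int open_Compl finite_imp_closed) auto
    show "?p \<in> T" by (simp add: T_def)
    show "(\<lambda>t. dunkl_E \<alpha> (of_real x * t) / ?I t / t ^ Suc n) holomorphic_on T - {?p}"
      using \<alpha> by (intro holomorphic_intros Ex bessel_I_norm_holomorphic) (auto simp: T_def)
    have "(?I has_field_derivative ?d) (at ?p)"
      using \<alpha> by (intro has_field_derivative_bessel_I_norm) auto
    then have "((\<lambda>t. ?I t / (t - ?p)) \<longlongrightarrow> 2 * of_real (\<alpha> + 1) * bessel_I_norm \<alpha> ?p / ?p) (at ?p)"
      unfolding d by (simp add: has_field_derivative_iff I0)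
    moreover have "((\<lambda>t. dunkl_E \<alpha> (of_real x * t) / t ^ Suc n) \<longlongrightarrow> dunkl_E \<alpha> (of_real x * ?p) / ?p ^ Suc n) (at ?p)"
    proof (rule tendsto_divide)
      have "isCont (\<lambda>t. dunkl_E \<alpha> (of_real x * t)) ?p"
        using holomorphic_on_imp_continuous_on[OF Ex[of UNIV]] by (simp add: continuous_on_eq_continuous_at)
      then show "((\<lambda>t. dunkl_E \<alpha> (of_real x * t)) \<longlongrightarrow> dunkl_E \<alpha> (of_real x * ?p)) (at ?p)"
        by (simp add: isCont_def)
    qed (use pole_neq_0[OF j] in \<open>auto intro!: tendsto_intros\<close>)
    ultimately have "((\<lambda>t. dunkl_E \<alpha> (of_real x * t) / t ^ Suc n / (?I t / (t - ?p))) \<longlongrightarrow>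
       dunkl_E \<alpha> (of_real x * ?p) / ?p ^ Suc n / (2 * of_real (\<alpha> + 1) * bessel_I_norm \<alpha> ?p / ?p)) (at ?p)"
      by (rule tendsto_divide[OF _ _ d0, rotated])
    also have "(\<lambda>t. dunkl_E \<alpha> (of_real x * t) / t ^ Suc n / (?I t / (t - ?p))) =
       (\<lambda>t. dunkl_E \<alpha> (of_real x * t) / ?I t / t ^ Suc n * (t - ?p))"
      by (simp add: mult_ac)
    also have "dunkl_E \<alpha> (of_real x * ?p) / ?p ^ Suc n / (2 * of_real (\<alpha> + 1) * bessel_I_norm \<alpha> ?p / ?p)
       = pole_coeff j n * eigenfun j x"
      using pole_neq_0[OF j] by (simp add: pole_coeff_def eigenfun_def mult_ac)
    finally show "((\<lambda>t. dunkl_E \<alpha> (of_real x * t) / ?I t / t ^ Suc n * (t - ?p)) \<longlongrightarrow>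
       pole_coeff j n * eigenfun j x) (at ?p)" .
  qed
qed

lemma nrm_remainder_bound:
  assumes \<rho>: "s (int N) < \<rho>" "\<rho> < s (int N + 1)"
  shows "\<exists>K. \<forall>n. nrm (remainder n (sym_indices N)) \<le> K * (1 / \<rho>) ^ n"
proof -
  let ?I = "bessel_I_norm (\<alpha> + 1)"
  let ?G = "\<lambda>x t. dunkl_E \<alpha> (of_real x * t) / ?I t"
  define R where "R = s (int N + 1)"
  define pts where "pts = insert 0 (pole ` sym_indices N)"
  have s0: "s (int N) \<ge> 0" using strict_mono_less_eq[OF strict_mono_s, of 0 "int N"] by simp
  have \<rho>0: "\<rho> > 0" using s0 \<rho> by linarith
  have zero_in: "z \<in> pts" if z: "norm z < R" "?I z = 0" for z
  proof -
    obtain j where j: "j \<noteq> 0" "z = pole j" using z by (auto simp: bessel_I_norm_zero_iff)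
    then have "s \<bar>j\<bar> < s (int N + 1)" using z by (simp add: norm_pole R_def)
    then have "\<bar>j\<bar> < int N + 1" by (simp add: strict_mono_less[OF strict_mono_s])
    with j have "j \<in> sym_indices N" by (auto simp: sym_indices_def)
    then show ?thesis using j by (auto simp: pts_def)
  qed
  have pts_norm: "norm z < \<rho>" if "z \<in> pts" for z
  proof (cases "z = 0")
    case False
    with that obtain j where j: "j \<in> sym_indices N" "z = pole j" by (auto simp: pts_def)
    then have "\<bar>j\<bar> \<le> int N" by (auto simp: sym_indices_def)
    then have "s \<bar>j\<bar> \<le> s (int N)" by (simp add: strict_mono_less_eq[OF strict_mono_s])
    then show ?thesis using j \<rho> by (simp add: norm_pole)
  qed (use \<rho>0 in simp)
  have Ec: "continuous_on A (dunkl_E \<alpha>)" for A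
    using has_field_derivative_dunkl_E[OF \<alpha>] by (meson DERIV_isCont continuous_at_imp_continuous_on)
  have Ic: "continuous_on A ?I" for A
    using \<alpha> by (intro holomorphic_on_imp_continuous_on bessel_I_norm_holomorphic) auto
  have nz: "?I t \<noteq> 0" "t \<noteq> 0" if "norm t = \<rho>" for t
    using zero_in[of t] pts_norm[of t] that \<rho> \<rho>0 by (auto simp: R_def)
  \<comment> \<open>Joint compactness gives one bound for all x and all t on the circle. The power
    of t is kept out of it, so the same \<open>M\<close> serves every \<open>n\<close>.\<close>
  have "continuous_on ({-1..1} \<times> sphere 0 \<rho>) (\<lambda>(x, t). ?G x t)"
    unfolding split_beta using nz
    by (intro continuous_intros continuous_on_compose2[OF Ec[of UNIV]] continuous_on_compose2[OF Ic[of UNIV]]) auto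
  then have "compact ((\<lambda>(x, t). ?G x t) ` ({-1..1} \<times> sphere 0 \<rho>))"
    by (intro compact_continuous_image compact_Times) auto
  then have "bounded ((\<lambda>(x, t). ?G x t) ` ({-1..1} \<times> sphere 0 \<rho>))"
    by (rule compact_imp_bounded)
  then obtain M where M': "\<And>y. y \<in> (\<lambda>(x, t). ?G x t) ` ({-1..1} \<times> sphere 0 \<rho>) \<Longrightarrow> norm y \<le> M"
    unfolding bounded_iff by blast
  have M: "norm (?G x t) \<le> M" if "x \<in> {-1..1}" "norm t = \<rho>" for x t
    using that by (intro M' image_eqI[of _ _ "(x, t)"]) auto
  have "norm (?G 0 (of_real \<rho>)) \<le> M"
    using \<rho>0 by (intro M) auto
  then have M0: "M \<ge> 0"
    by (rule order_trans[OF norm_ge_zero])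
  have main: "norm (remainder n (sym_indices N) x) \<le> M * (1 / \<rho>) ^ n" if x: "x \<in> {-1..1}" for n x
  proof -
    let ?f = "\<lambda>t. ?G x t / t ^ Suc n"
    have Ex: "(\<lambda>t. dunkl_E \<alpha> (of_real x * t)) holomorphic_on A" for A
      by (rule dunkl_E_holomorphic[OF \<alpha>])
    have holo: "?f holomorphic_on ball 0 R - pts"
      using \<alpha> zero_in by (intro holomorphic_intros Ex bessel_I_norm_holomorphic) (auto simp: pts_def)
    have img: "path_image (circlepath 0 \<rho>) \<subseteq> ball 0 R - pts"
      using \<rho>0 \<rho> pts_norm by (fastforce simp: R_def)
    have fin: "finite pts" by (simp add: pts_def)
    have notin: "0 \<notin> pole ` sym_indices N" using pole_neq_0 zero_notin_sym_indices by (metis imageE)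
    have "contour_integral (circlepath 0 \<rho>) ?f =
        2 * pi * \<i> * (\<Sum>p\<in>pts. winding_number (circlepath 0 \<rho>) p * residue ?f p)"
    proof (rule Residue_theorem[OF _ _ fin holo])
      show "\<forall>z. z \<notin> ball 0 R \<longrightarrow> winding_number (circlepath 0 \<rho>) z = 0"
        using img by (intro allI impI winding_number_zero_outside[where s = "ball 0 R"]) auto
    qed (use img in auto)
    also have "(\<Sum>p\<in>pts. winding_number (circlepath 0 \<rho>) p * residue ?f p) = (\<Sum>p\<in>pts. residue ?f p)"
      using pts_norm by (intro sum.cong refl) (simp add: winding_number_circlepath)
    also have "\<dots> = residue ?f 0 + (\<Sum>p\<in>pole ` sym_indices N. residue ?f p)"
      unfolding pts_def by (subst sum.insert) (simp_all add: notin)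
    \<comment> \<open>Division by t^(n+1) makes the residue at 0 the coefficient of t^n.\<close>
    also have "residue ?f 0 = bernoulli_coeff \<alpha> n x"
      unfolding bernoulli_coeff_def by (rule residue_fps_expansion_over_power_at_0[OF generating_function_has_fps_expansion[OF \<alpha>]])
    also have "(\<Sum>p\<in>pole ` sym_indices N. residue ?f p) = (\<Sum>j\<in>sym_indices N. residue ?f (pole j))"
      by (subst sum.reindex) (auto simp: inj_on_def pole_eq_iff)
    also have "\<dots> = (\<Sum>j\<in>sym_indices N. pole_coeff j n * eigenfun j x)"
      by (intro sum.cong refl residue_at_pole) (auto simp: sym_indices_def)
    finally have ci: "contour_integral (circlepath 0 \<rho>) ?f = 2 * pi * \<i> * remainder n (sym_indices N) x"
      by (simp add: remainder_def)
    have "?f contour_integrable_on (circlepath 0 \<rho>)"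
      using fin by (intro contour_integrable_holomorphic_simple[OF holo _ _ img] open_Diff finite_imp_closed) auto
    then have "(?f has_contour_integral (2 * pi * \<i> * remainder n (sym_indices N) x)) (circlepath 0 \<rho>)"
      using has_contour_integral_integral ci by metis
    then have "norm (2 * pi * \<i> * remainder n (sym_indices N) x) \<le> M / \<rho> ^ Suc n * (2 * pi * \<rho>)"
    proof (rule has_contour_integral_bound_circlepath)
      show "norm (?f t) \<le> M / \<rho> ^ Suc n" if "norm (t - 0) = \<rho>" for t
      proof -
        have "norm (?G x t) \<le> M" using M[OF x] that by simp
        then have "norm (?G x t) / \<rho> ^ Suc n \<le> M / \<rho> ^ Suc n"
          using \<rho>0 by (intro divide_right_mono) auto
        moreover have "norm (?f t) = norm (?G x t) / \<rho> ^ Suc n"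
          using that by (simp only: norm_divide norm_power diff_zero)
        ultimately show ?thesis by simp
      qed
    qed (use M0 \<rho>0 in auto)
    then have "2 * pi * norm (remainder n (sym_indices N) x) \<le> 2 * pi * (M / \<rho> ^ n)"
      using \<rho>0 by (simp add: norm_mult field_simps)
    then have "norm (remainder n (sym_indices N) x) \<le> M / \<rho> ^ n"
      by (rule mult_left_le_imp_le) simp
    then show ?thesis by (simp add: power_divide)
  qed
  show ?thesis
  proof (intro exI allI)
    fix n
    show "nrm (remainder n (sym_indices N)) \<le> (M * nrm (\<lambda>_. 1)) * (1 / \<rho>) ^ n"
      using norm_L2_le_bound[OF \<alpha> continuous_remainder[of UNIV n "sym_indices N"] main[of _ n]] by (simp add: mult_ac)
  qed
qed

lemma s_gap: obtains \<rho> where "s (int N) < \<rho>" "\<rho> < s (int N + 1)" "\<rho> > 0"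
proof -
  have "s (int N) < s (int N + 1)" by (simp add: strict_mono_less[OF strict_mono_s])
  then obtain \<rho> where "s (int N) < \<rho>" "\<rho> < s (int N + 1)" using dense by blast
  moreover have "s (int N) \<ge> 0" using strict_mono_less_eq[OF strict_mono_s, of 0 "int N"] by simp
  ultimately show ?thesis using that by auto
qed

text \<open>
  Iterating the antisymmetry gives \<open>\<langle>r\<^sub>n, e\<^sub>k\<rangle> = p\<^sub>k\<^sup>m \<langle>r\<^bsub>n+m\<^esub>, e\<^sub>k\<rangle>\<close> with a pole \<open>p\<^sub>k\<close> inside the
  circle of radius \<open>\<rho>\<close>, so the bound \<open>\<rho>\<^bsup>-n-m\<^esup>\<close> forces it to vanish.
\<close>

lemma dunkl_inner_remainder_sym_indices:
  assumes k: "k \<in> sym_indices N" and n: "n \<ge> 1"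
  shows "dunkl_inner \<alpha> (remainder n (sym_indices N)) (eigenfun k) = 0"
proof -
  obtain \<rho> where \<rho>: "s (int N) < \<rho>" "\<rho> < s (int N + 1)" "\<rho> > 0" by (rule s_gap)
  obtain K where K: "\<And>n. nrm (remainder n (sym_indices N)) \<le> K * (1 / \<rho>) ^ n"
    using nrm_remainder_bound[OF \<rho>(1,2)] by blast
  have k0: "k \<noteq> 0" using k by (auto simp: sym_indices_def)
  have iter: "dunkl_inner \<alpha> (remainder n (sym_indices N)) (eigenfun k) =
      pole k ^ m * dunkl_inner \<alpha> (remainder (n + m) (sym_indices N)) (eigenfun k)" for m
  proof (induction m)
    case (Suc m)
    then show ?case using dunkl_inner_remainder_Suc[of "sym_indices N" k "n + m"] k0 n by simp
  qed simp
  define q where "q = s \<bar>k\<bar> / \<rho>"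
  have "\<bar>k\<bar> \<le> int N" using k by (auto simp: sym_indices_def)
  then have "s \<bar>k\<bar> \<le> s (int N)" by (simp add: strict_mono_less_eq[OF strict_mono_s])
  moreover have "s \<bar>k\<bar> \<ge> 0" using norm_pole[of k] norm_ge_zero by metis
  ultimately have q: "0 \<le> q" "q < 1" using \<rho> by (auto simp: q_def)
  have bound: "cmod (dunkl_inner \<alpha> (remainder n (sym_indices N)) (eigenfun k)) \<le> (K * (1 / \<rho>) ^ n * nrm (eigenfun k)) * q ^ m" for m
  proof -
    have "cmod (dunkl_inner \<alpha> (remainder n (sym_indices N)) (eigenfun k)) =
       s \<bar>k\<bar> ^ m * cmod (dunkl_inner \<alpha> (remainder (n + m) (sym_indices N)) (eigenfun k))"
      by (subst iter[of m]) (simp add: norm_mult norm_power norm_pole)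
    also have "\<dots> \<le> s \<bar>k\<bar> ^ m * (nrm (remainder (n + m) (sym_indices N)) * nrm (eigenfun k))"
      using \<open>s \<bar>k\<bar> \<ge> 0\<close>
      by (intro mult_left_mono dunkl_inner_Cauchy_Schwarz \<alpha> continuous_remainder continuous_eigenfun) auto
    also have "\<dots> \<le> s \<bar>k\<bar> ^ m * (K * (1 / \<rho>) ^ (n + m) * nrm (eigenfun k))"
      using \<open>s \<bar>k\<bar> \<ge> 0\<close> by (intro mult_left_mono mult_right_mono K norm_L2_nonneg) auto
    also have "\<dots> = (K * (1 / \<rho>) ^ n * nrm (eigenfun k)) * q ^ m"
      by (simp add: q_def power_add power_divide mult_ac)
    finally show ?thesis .
  qed
  have "(\<lambda>m. (K * (1 / \<rho>) ^ n * nrm (eigenfun k)) * q ^ m) \<longlonglongrightarrow> (K * (1 / \<rho>) ^ n * nrm (eigenfun k)) * 0"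
    using q by (intro tendsto_mult_left LIMSEQ_realpow_zero)
  then have "cmod (dunkl_inner \<alpha> (remainder n (sym_indices N)) (eigenfun k)) \<le> 0"
    using bound by (intro LIMSEQ_le_const) auto
  then show ?thesis by simp
qed

section \<open>Orthogonality and monotonicity for arbitrary finite index sets\<close>

lemma remainder_superset:
  assumes "finite G" "F \<subseteq> G"
  shows "remainder n F x = remainder n G x + (\<Sum>j\<in>G - F. - pole_coeff j n * eigenfun j x)"
proof -
  have "(\<Sum>j\<in>G. pole_coeff j n * eigenfun j x) = (\<Sum>j\<in>G - F. pole_coeff j n * eigenfun j x) + (\<Sum>j\<in>F. pole_coeff j n * eigenfun j x)"
    using assms by (rule sum.subset_diff[rotated])
  then show ?thesis by (simp add: remainder_def sum_negf)
qed

text \<open>Enlarge \<open>F\<close> to a symmetric set, where orthogonality is known. The surplus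
  terms are eigenfunctions with index outside \<open>F\<close>, hence orthogonal to the one with
  index \<open>k\<close>.\<close>

lemma dunkl_inner_remainder:
  assumes F: "finite F" "0 \<notin> F" and k: "k \<in> F" and n: "n \<ge> 1"
  shows "dunkl_inner \<alpha> (remainder n F) (eigenfun k) = 0"
proof -
  have "finite (abs ` F)" using F by simp
  then obtain B where B: "\<And>j. j \<in> F \<Longrightarrow> \<bar>j\<bar> \<le> B"
    by (meson Max_ge imageI)
  define N where "N = nat B"
  have sub: "F \<subseteq> sym_indices N"
  proof
    fix j assume "j \<in> F"
    then have "\<bar>j\<bar> \<le> B" "j \<noteq> 0" using B F by auto
    then show "j \<in> sym_indices N" by (auto simp: sym_indices_def N_def)
  qed
  have "dunkl_inner \<alpha> (remainder n F) (eigenfun k) =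
    dunkl_inner \<alpha> (\<lambda>x. remainder n (sym_indices N) x + (\<Sum>j\<in>sym_indices N - F. - pole_coeff j n * eigenfun j x)) (eigenfun k)"
    by (rule arg_cong2[where f = "dunkl_inner \<alpha>"]) (simp_all add: remainder_superset[OF finite_sym_indices sub, of n, abs_def] fun_eq_iff)
  also have "\<dots> = dunkl_inner \<alpha> (remainder n (sym_indices N)) (eigenfun k) +
     (\<Sum>j\<in>sym_indices N - F. - pole_coeff j n * dunkl_inner \<alpha> (eigenfun j) (eigenfun k))"
    by (subst dunkl_inner_add_left[OF \<alpha>], (intro continuous_intros continuous_remainder continuous_eigenfun)+,
        subst dunkl_inner_sum_left[OF \<alpha>], (intro continuous_intros continuous_eigenfun)+,
        simp only: dunkl_inner_cmult_left)
  also have "(\<Sum>j\<in>sym_indices N - F. - pole_coeff j n * dunkl_inner \<alpha> (eigenfun j) (eigenfun k)) = 0"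
    using k sub by (intro sum.neutral ballI) (auto simp: sym_indices_def intro!: dunkl_inner_eigenfun)
  also have "dunkl_inner \<alpha> (remainder n (sym_indices N)) (eigenfun k) = 0"
    using k sub n by (intro dunkl_inner_remainder_sym_indices) auto
  finally show ?thesis by simp
qed

lemma nrm_remainder_le:
  assumes "finite F" "0 \<notin> F" "n \<ge> 1"
  shows "nrm (remainder n F) \<le> nrm (\<lambda>x. remainder n F x + (\<Sum>j\<in>F. d j * eigenfun j x))"
  using assms by (intro norm_L2_le_of_orthogonal \<alpha> continuous_remainder continuous_eigenfun dunkl_inner_remainder)

text \<open>Passing from \<open>G\<close> back to \<open>F\<close> adds eigenfunctions orthogonal to
  the remainder of \<open>G\<close>, which cannot lower the norm.\<close>

lemma nrm_remainder_antimono: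
  assumes "finite G" "0 \<notin> G" "F \<subseteq> G" "n \<ge> 1"
  shows "nrm (remainder n G) \<le> nrm (remainder n F)"
proof -
  have "nrm (remainder n G) \<le> nrm (\<lambda>x. remainder n G x + (\<Sum>j\<in>G - F. - pole_coeff j n * eigenfun j x))"
    using assms by (intro norm_L2_le_of_orthogonal \<alpha> continuous_remainder continuous_eigenfun dunkl_inner_remainder) auto
  also have "(\<lambda>x. remainder n G x + (\<Sum>j\<in>G - F. - pole_coeff j n * eigenfun j x)) = remainder n F"
    using remainder_superset[OF assms(1,3)] by auto
  finally show ?thesis .
qed

lemma nrm_remainder_sym_indices_Suc_le:
  assumes N: "N \<ge> 1" and n: "n \<ge> 1"
  shows "nrm (remainder (Suc n) (sym_indices N)) \<le> nrm (bernoulli_coeff \<alpha> n) / s (int N)"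
proof -
  obtain \<rho> where \<rho>: "s (int N) < \<rho>" "\<rho> < s (int N + 1)" "\<rho> > 0" by (rule s_gap)
  obtain K where K: "\<And>n. nrm (remainder n (sym_indices N)) \<le> K * (1 / \<rho>) ^ n"
    using nrm_remainder_bound[OF \<rho>(1,2)] by blast
  obtain m where m: "n = Suc m" using n by (cases n) auto
  \<comment> \<open>The shift starts the sequence at index 1, where log-convexity begins.\<close>
  define a where "a n = nrm (remainder (Suc n) (sym_indices N))" for n
  have "a (Suc m) \<le> 1 / \<rho> * a m"
  proof (rule log_convex_geometric_decay)
    show "a i \<ge> 0" for i by (simp add: a_def norm_L2_nonneg)
    show "(a (Suc i))\<^sup>2 \<le> a i * a (Suc (Suc i))" for i
      unfolding a_def by (rule nrm_remainder_log_convex) auto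
    show "a i \<le> K * (1 / \<rho>) * (1 / \<rho>) ^ i" for i
      using K[of "Suc i"] by (simp add: a_def mult_ac)
  qed (use \<rho> in simp)
  also have "\<dots> \<le> 1 / s (int N) * a m"
    using \<rho> s_pos[of "int N"] N by (intro mult_right_mono divide_left_mono) (auto simp: a_def norm_L2_nonneg)
  also have "\<dots> \<le> 1 / s (int N) * nrm (bernoulli_coeff \<alpha> n)"
  proof (rule mult_left_mono)
    \<comment> \<open>The empty index set leaves \<open>bernoulli_coeff\<close> itself, so the
      numerator of the bound is independent of \<open>N\<close>.\<close>
    have "nrm (remainder n (sym_indices N)) \<le> nrm (remainder n {})"
      using n by (intro nrm_remainder_antimono) auto
    then show "a m \<le> nrm (bernoulli_coeff \<alpha> n)" by (simp add: a_def m remainder_def [abs_def])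
    show "0 \<le> 1 / s (int N)" using s_pos[of "int N"] N by simp
  qed
  finally show ?thesis by (simp add: a_def m)
qed

section \<open>Convergence of the remainders to zero\<close>

lemma s_at_top: "filterlim (\<lambda>N. s (int N)) at_top sequentially"
proof (rule filterlim_at_top[THEN iffD2, rule_format])
  fix B
  obtain n where n: "s (int n) > B" using s_unbounded by blast
  show "\<forall>\<^sub>F N in sequentially. B \<le> s (int N)"
    using eventually_ge_at_top[of n]
  proof eventually_elim
    case (elim N)
    then have "s (int n) \<le> s (int N)" by (simp add: strict_mono_less_eq[OF strict_mono_s])
    then show ?case using n by simp
  qed
qed

lemma nrm_remainder_sym_indices_tendsto_ge_2:
  assumes "n \<ge> 2"
  shows "(\<lambda>N. nrm (remainder n (sym_indices N))) \<longlonglongrightarrow> 0"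
proof -
  obtain m where m: "n = Suc m" "m \<ge> 1" using assms by (cases n) auto
  have "(\<lambda>N. nrm (bernoulli_coeff \<alpha> m) / s (int N)) \<longlonglongrightarrow> 0"
    by (rule real_tendsto_divide_at_top[OF tendsto_const s_at_top])
  then show ?thesis
  proof (rule tendsto_sandwich[OF _ _ tendsto_const, rotated 2])
    show "\<forall>\<^sub>F N in sequentially. nrm (remainder n (sym_indices N)) \<le> nrm (bernoulli_coeff \<alpha> m) / s (int N)"
      using eventually_ge_at_top[of 1] by eventually_elim (unfold m(1), rule nrm_remainder_sym_indices_Suc_le[OF _ m(2)])
  qed (simp add: norm_L2_nonneg)
qed

text \<open>
  The case \<open>n = 1\<close> has no predecessor with a bounded remainder. It is reached through the polynomials
  of higher degree, up to a monomial that is small in \<open>L\<^sup>2\<close>.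
\<close>

lemma bernoulli_coeff_1_eq:
  "bernoulli_coeff \<alpha> 1 x = of_real x ^ (2 * l + 1) / of_real (2 * (\<alpha> + 1)) -
     (\<Sum>k<2 * l. fps_nth (bessel_I_fps (\<alpha> + 1)) k * of_real (dunkl_gamma (2 * l) (\<alpha> + 1)) * bernoulli_coeff \<alpha> (2 * l + 1 - k) x)"
proof -
  define i where "i = fps_nth (bessel_I_fps (\<alpha> + 1))"
  define g where "g = complex_of_real (dunkl_gamma (2 * l) (\<alpha> + 1))"
  have g0: "g \<noteq> 0" using dunkl_gamma_pos[of "\<alpha> + 1" "2 * l"] \<alpha> by (simp add: g_def)
  have gm: "complex_of_real (dunkl_gamma (2 * l + 1) \<alpha>) = of_real (2 * (\<alpha> + 1)) * g"
    unfolding dunkl_gamma_odd g_def by simp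
  \<comment> \<open>Compare coefficients of t^(2l+1) after multiplication by the denominator. Index
    2l + 1 drops out by evenness, index 2l carries \<open>bernoulli_coeff \<alpha> 1\<close>, and
    smaller ones carry coefficients of index at least 2.\<close>
  have "of_real x ^ (2 * l + 1) / of_real (dunkl_gamma (2 * l + 1) \<alpha>) =
      fps_nth (bessel_I_fps (\<alpha> + 1) * bernoulli_dunkl_fps \<alpha> (of_real x)) (2 * l + 1)"
    by (subst mult.commute) (simp add: bernoulli_dunkl_fps_mult dunkl_E_fps_def)
  also have "\<dots> = (\<Sum>k\<le>2 * l + 1. i k * bernoulli_coeff \<alpha> (2 * l + 1 - k) x)"
    unfolding fps_mult_nth i_def bernoulli_coeff_def atLeast0AtMost ..
  also have "\<dots> = (\<Sum>k<2 * l. i k * bernoulli_coeff \<alpha> (2 * l + 1 - k) x) + i (2 * l) * bernoulli_coeff \<alpha> 1 x + i (2 * l + 1) * bernoulli_coeff \<alpha> 0 x"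
    by (simp add: lessThan_Suc_atMost [symmetric])
  also have "i (2 * l + 1) = 0" by (simp add: i_def bessel_I_fps_def)
  also have "i (2 * l) = 1 / g" by (simp add: i_def bessel_I_fps_def g_def)
  finally have "g * (of_real x ^ (2 * l + 1) / (of_real (2 * (\<alpha> + 1)) * g)) =
     g * ((\<Sum>k<2 * l. i k * bernoulli_coeff \<alpha> (2 * l + 1 - k) x) + 1 / g * bernoulli_coeff \<alpha> 1 x)"
    unfolding gm by simp
  moreover have "g * (X / (A * g)) = X / A" for X A
    using g0 by simp
  moreover have "g * (X + 1 / g * Y) = g * X + Y" for X Y
    using g0 by (simp add: distrib_left)
  ultimately have "of_real x ^ (2 * l + 1) / of_real (2 * (\<alpha> + 1)) =
     g * (\<Sum>k<2 * l. i k * bernoulli_coeff \<alpha> (2 * l + 1 - k) x) + bernoulli_coeff \<alpha> 1 x"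
    by metis
  moreover have "g * (\<Sum>k<2 * l. i k * bernoulli_coeff \<alpha> (2 * l + 1 - k) x) = (\<Sum>k<2 * l. i k * g * bernoulli_coeff \<alpha> (2 * l + 1 - k) x)"
    by (simp add: sum_distrib_left mult_ac)
  ultimately show ?thesis unfolding i_def g_def by (simp only: add_diff_cancel_left')
qed

text \<open>The monomial and the higher remainders combine to a function that differs from the first
  remainder only by eigenfunctions with index in \<open>F\<close>; by orthogonality the first
  remainder has the smaller norm.\<close>

lemma nrm_remainder_1_le:
  assumes F: "finite F" "0 \<notin> F"
  shows "nrm (remainder 1 F) \<le> nrm (\<lambda>x. of_real x ^ (2 * l + 1)) / (2 * (\<alpha> + 1)) +
    (\<Sum>k<2 * l. cmod (fps_nth (bessel_I_fps (\<alpha> + 1)) k * of_real (dunkl_gamma (2 * l) (\<alpha> + 1))) *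
       nrm (remainder (2 * l + 1 - k) F))"
proof -
  define c where "c k = - (fps_nth (bessel_I_fps (\<alpha> + 1)) k * complex_of_real (dunkl_gamma (2 * l) (\<alpha> + 1)))" for k
  define a where "a = complex_of_real (1 / (2 * (\<alpha> + 1)))"
  define q where "q x = a * of_real x ^ (2 * l + 1) + (\<Sum>k<2 * l. c k * remainder (2 * l + 1 - k) F x)" for x
  \<comment> \<open>These are the coefficients of the eigenfunctions by which \<open>q\<close>
    exceeds the first remainder.\<close>
  define d where "d j = (\<Sum>k<2 * l. c k * pole_coeff j (2 * l + 1 - k)) - pole_coeff j 1" for j
  have q: "q = (\<lambda>x. remainder 1 F x + (\<Sum>j\<in>F. d j * eigenfun j x))"
  proof
    fix x
    have "(\<Sum>k<2 * l. c k * (\<Sum>j\<in>F. pole_coeff j (2 * l + 1 - k) * eigenfun j x)) =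
        (\<Sum>j\<in>F. (\<Sum>k<2 * l. c k * pole_coeff j (2 * l + 1 - k)) * eigenfun j x)"
      unfolding sum_distrib_left sum_distrib_right by (subst sum.swap) (simp add: mult.assoc)
    moreover have "bernoulli_coeff \<alpha> 1 x = a * of_real x ^ (2 * l + 1) + (\<Sum>k<2 * l. c k * bernoulli_coeff \<alpha> (2 * l + 1 - k) x)"
      unfolding bernoulli_coeff_1_eq[of x l] a_def c_def by (simp add: sum_negf)
    ultimately show "q x = remainder 1 F x + (\<Sum>j\<in>F. d j * eigenfun j x)"
      unfolding q_def remainder_def d_def
      by (simp add: distrib_left sum.distrib left_diff_distrib sum_subtractf)
  qed
  have "nrm (remainder 1 F) \<le> nrm q"
    unfolding q by (rule nrm_remainder_le[OF F]) simp
  also have "\<dots> \<le> nrm (\<lambda>x. a * of_real x ^ (2 * l + 1)) + nrm (\<lambda>x. \<Sum>k<2 * l. c k * remainder (2 * l + 1 - k) F x)"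
    unfolding q_def by (intro norm_L2_triangle \<alpha> continuous_intros continuous_remainder)
  also have "nrm (\<lambda>x. \<Sum>k<2 * l. c k * remainder (2 * l + 1 - k) F x) \<le> (\<Sum>k<2 * l. nrm (\<lambda>x. c k * remainder (2 * l + 1 - k) F x))"
    by (intro norm_L2_sum_le \<alpha> continuous_intros continuous_remainder)
  finally have "nrm (remainder 1 F) \<le> cmod a * nrm (\<lambda>x. of_real x ^ (2 * l + 1)) +
      (\<Sum>k<2 * l. cmod (c k) * nrm (remainder (2 * l + 1 - k) F))"
    unfolding norm_L2_cmult by simp
  moreover have "cmod a = 1 / (2 * (\<alpha> + 1))"
    using \<alpha> unfolding a_def norm_of_real by simp
  ultimately show ?thesis
    by (simp only: c_def norm_minus_cancel times_divide_eq_left mult_1_left)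
qed

lemma nrm_remainder_sym_indices_tendsto:
  assumes "n \<ge> 1"
  shows "(\<lambda>N. nrm (remainder n (sym_indices N))) \<longlonglongrightarrow> 0"
proof (cases "n = 1")
  case False
  then show ?thesis using assms by (intro nrm_remainder_sym_indices_tendsto_ge_2) auto
next
  case True
  show ?thesis unfolding True
  proof (rule LIMSEQ_I)
    fix \<epsilon> :: real assume \<epsilon>: "\<epsilon> > 0"
    have "strict_mono (\<lambda>l::nat. 2 * l + 1)" by (rule strict_monoI) simp
    from LIMSEQ_subseq_LIMSEQ[OF norm_L2_monomial_tendsto_0[OF \<alpha>] this]
    have "(\<lambda>l. nrm (\<lambda>x. of_real x ^ (2 * l + 1)) / (2 * (\<alpha> + 1))) \<longlonglongrightarrow> 0 / (2 * (\<alpha> + 1))"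
      using \<alpha> by (intro tendsto_divide tendsto_const) (auto simp: o_def)
    then have "\<forall>\<^sub>F l in sequentially. nrm (\<lambda>x. of_real x ^ (2 * l + 1)) / (2 * (\<alpha> + 1)) < \<epsilon> / 2"
      using \<epsilon> by (intro order_tendstoD) auto
    \<comment> \<open>The degree is fixed first, to make the monomial small. The sum that is left
      has finitely many remainders of index at least 2, which a large \<open>N\<close> makes
      small.\<close>
    then obtain l where l: "nrm (\<lambda>x. of_real x ^ (2 * l + 1)) / (2 * (\<alpha> + 1)) < \<epsilon> / 2"
      by (auto simp: eventually_sequentially)
    let ?S = "\<lambda>N. \<Sum>k<2 * l. cmod (fps_nth (bessel_I_fps (\<alpha> + 1)) k * of_real (dunkl_gamma (2 * l) (\<alpha> + 1))) *
       nrm (remainder (2 * l + 1 - k) (sym_indices N))"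
    have "?S \<longlonglongrightarrow> (\<Sum>k<2 * l. cmod (fps_nth (bessel_I_fps (\<alpha> + 1)) k * of_real (dunkl_gamma (2 * l) (\<alpha> + 1))) * 0)"
      by (intro tendsto_sum tendsto_mult_left nrm_remainder_sym_indices_tendsto_ge_2) auto
    then have "\<forall>\<^sub>F N in sequentially. ?S N < \<epsilon> / 2"
      using \<epsilon> by (intro order_tendstoD) auto
    then obtain N0 where N0: "\<And>N. N \<ge> N0 \<Longrightarrow> ?S N < \<epsilon> / 2"
      by (auto simp: eventually_sequentially)
    have "norm (nrm (remainder 1 (sym_indices N)) - 0) < \<epsilon>" if "N \<ge> N0" for N
    proof -
      have "nrm (remainder 1 (sym_indices N)) < \<epsilon> / 2 + \<epsilon> / 2"
        using nrm_remainder_1_le[OF finite_sym_indices zero_notin_sym_indices, of N l] l N0[OF that] by linarith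
      then show ?thesis by (simp add: norm_L2_nonneg)
    qed
    then show "\<exists>no. \<forall>N\<ge>no. norm (nrm (remainder 1 (sym_indices N)) - 0) < \<epsilon>" by blast
  qed
qed

text \<open>Monotonicity carries a bound reached at one symmetric set over to every finite set that
  contains it, which upgrades symmetric to unordered convergence.\<close>

lemma nrm_remainder_tendsto:
  assumes "n \<ge> 1"
  shows "((\<lambda>F. nrm (remainder n F)) \<longlongrightarrow> 0) (finite_subsets_at_top (UNIV - {0}))"
proof (rule tendstoI)
  fix \<epsilon> :: real assume "\<epsilon> > 0"
  then have "\<forall>\<^sub>F N in sequentially. nrm (remainder n (sym_indices N)) < \<epsilon>"
    using nrm_remainder_sym_indices_tendsto[OF assms] by (intro order_tendstoD) auto
  then obtain N where N: "nrm (remainder n (sym_indices N)) < \<epsilon>"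
    by (auto simp: eventually_sequentially)
  show "\<forall>\<^sub>F F in finite_subsets_at_top (UNIV - {0}). dist (nrm (remainder n F)) 0 < \<epsilon>"
    unfolding eventually_finite_subsets_at_top
  proof (intro exI[of _ "sym_indices N"] conjI allI impI)
    show "sym_indices N \<subseteq> UNIV - {0}" using zero_notin_sym_indices by blast
    fix F assume F: "finite F \<and> sym_indices N \<subseteq> F \<and> F \<subseteq> UNIV - {0}"
    then have "0 \<notin> F" by blast
    then have "nrm (remainder n F) \<le> nrm (remainder n (sym_indices N))"
      using F assms by (intro nrm_remainder_antimono) auto
    then show "dist (nrm (remainder n F)) 0 < \<epsilon>"
      using N norm_L2_nonneg[of "dunkl_measure \<alpha>" "remainder n F"] by (simp add: dist_real_def)
  qed simp
qed

section \<open>Return to the Fourier-Dunkl normalisation\<close>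

lemma fourier_dunkl_eq:
  assumes "j \<noteq> 0"
  shows "(-1) powi j / of_real (s j) ^ n * fourier_dunkl \<alpha> s j x =
     of_real (2 powr (1 + \<alpha> / 2) * (\<alpha> + 1) * sqrt (Gamma (\<alpha> + 1))) / (- \<i>) ^ n * (pole_coeff j n * eigenfun j x)"
proof -
  define I where "I = bessel_I_norm \<alpha> (pole j)"
  define A where "A = complex_of_real (2 powr (\<alpha> / 2) * sqrt (Gamma (\<alpha> + 1)))"
  define e :: complex where "e = (-1) powi j"
  have e: "e * e = 1"
    unfolding e_def by (cases "j \<ge> 0") (auto simp: power_int_def simp flip: power_mult_distrib)
  have I: "I = e * of_real (cmod I)" "I \<noteq> 0"
    unfolding I_def e_def by (rule bessel_I_norm_pole, rule bessel_I_norm_pole_neq_0)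
  \<comment> \<open>The sign \<open>e\<close> is its own inverse, so sign over modulus is the
    reciprocal of the value at the pole.\<close>
  have "e / c = 1 / (e * c)" if "c \<noteq> 0" for c
    using e that by (subst frac_eq_eq) (auto simp flip: mult.assoc)
  from this[of "of_real (cmod I)"] have 1: "e / of_real (cmod I) = 1 / I"
    using I by simp
  have 2: "(-1) powi j / of_real (s j) ^ n * fourier_dunkl \<alpha> s j x =
      A * (e / of_real (cmod I)) / of_real (s j) ^ n * eigenfun j x"
    using assms by (simp add: fourier_dunkl_def e_def A_def I_def eigenfun_def pole_def mult_ac)
  have 3: "of_real (2 powr (1 + \<alpha> / 2) * (\<alpha> + 1) * sqrt (Gamma (\<alpha> + 1))) = 2 * of_real (\<alpha> + 1) * A"
    by (simp add: A_def powr_add)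
  have 4: "pole_coeff j n = 1 / (2 * of_real (\<alpha> + 1)) * (1 / I) / (\<i> ^ n * of_real (s j) ^ n)"
    by (simp add: pole_coeff_def I_def pole_def power_mult_distrib)
  have cancel: "A * X / S * E = c * A / p * (1 / c * X / (q * S) * E)" if "c \<noteq> 0" "p * q = 1" for c p q X S E
  proof -
    have "p \<noteq> 0" using that(2) by auto
    then have "q = 1 / p" using that(2) by (simp add: eq_divide_eq mult.commute)
    then show ?thesis using that(1) \<open>p \<noteq> 0\<close> by simp
  qed
  \<comment> \<open>This accounts for the power (-\<i>)^n in the theorem: the n-th power of the pole
    contains \<i>^n.\<close>
  have 5: "(- \<i>) ^ n * \<i> ^ n = 1"
    by (simp flip: power_mult_distrib)
  have 6: "2 * complex_of_real (\<alpha> + 1) \<noteq> 0"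
  proof -
    have "complex_of_real (\<alpha> + 1) \<noteq> 0" unfolding of_real_eq_0_iff using \<alpha> by simp
    then show ?thesis by (metis mult_eq_0_iff zero_neq_numeral)
  qed
  show ?thesis
    unfolding 2 1 3 4 by (rule cancel[OF 6 5])
qed

end

theorem theorem5p4:
  fixes \<alpha> :: real and n :: nat and s :: "int \<Rightarrow> real"
  assumes "\<alpha> > -1" and "n \<ge> 1"
    and "is_bessel_zeros \<alpha> s"
  shows "\<exists>S. has_sum_L2 (dunkl_measure \<alpha>)
               (\<lambda>j x. (-1) powi j / of_real (s j) ^ n * fourier_dunkl \<alpha> s j x) S (UNIV - {0}) \<and>
             (AE x in dunkl_measure \<alpha>.
                bernoulli_dunkl n \<alpha> (of_real x) =
                  - ((- \<i>) ^ n) * of_real (dunkl_gamma n \<alpha>) /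
                    of_real (2 powr (1 + \<alpha> / 2) * (\<alpha> + 1) * sqrt (Gamma (\<alpha> + 1))) * S x)"
proof -
  interpret bessel_zeros \<alpha> s
    using assms by unfold_locales
  define C where "C = complex_of_real (2 powr (1 + \<alpha> / 2) * (\<alpha> + 1) * sqrt (Gamma (\<alpha> + 1)))"
  have "Gamma (\<alpha> + 1) > 0" using \<alpha> by (intro Gamma_real_pos) auto
  then have "Gamma (\<alpha> + 1) \<noteq> 0" by (metis less_irrefl)
  then have C0: "C \<noteq> 0"
    unfolding C_def of_real_eq_0_iff using \<alpha> by simp
  define D where "D = C / (- \<i>) ^ n"
  \<comment> \<open>The limit is found by solving the asserted identity for the series; each partial
    sum minus \<open>S\<close> is then \<open>D\<close> times a remainder.\<close>
  define S where "S x = - D * bernoulli_coeff \<alpha> n x" for x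
  define t where "t = (\<lambda>j x. (-1) powi j / of_real (s j) ^ n * fourier_dunkl \<alpha> s j x)"
  have t: "t j = (\<lambda>x. D * (pole_coeff j n * eigenfun j x))" if "j \<noteq> 0" for j
    unfolding t_def D_def C_def fourier_dunkl_eq[OF that] ..
  have "has_sum_L2 (dunkl_measure \<alpha>) t S (UNIV - {0})"
    unfolding has_sum_L2_def
  proof (intro conjI ballI)
    show "square_integrable (dunkl_measure \<alpha>) (t j)" if "j \<in> UNIV - {0}" for j
      using that by (simp add: t) (intro square_integrable_dunkl_measure \<alpha> continuous_intros continuous_eigenfun)
    show "square_integrable (dunkl_measure \<alpha>) S"
      unfolding S_def by (intro square_integrable_dunkl_measure \<alpha> continuous_intros continuous_bernoulli_coeff)
    have "((\<lambda>F. cmod D * nrm (remainder n F)) \<longlongrightarrow> cmod D * 0) (finite_subsets_at_top (UNIV - {0}))"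
      by (intro tendsto_mult_left nrm_remainder_tendsto assms)
    moreover have "\<forall>\<^sub>F F in finite_subsets_at_top (UNIV - {0}).
        cmod D * nrm (remainder n F) = nrm (\<lambda>x. (\<Sum>j\<in>F. t j x) - S x)"
    proof (rule eventually_finite_subsets_at_top_weakI)
      fix F :: "int set" assume F: "finite F" "F \<subseteq> UNIV - {0}"
      have "t j x = D * (pole_coeff j n * eigenfun j x)" if "j \<in> F" for j x
      proof -
        have "j \<noteq> 0" using that F by blast
        then show ?thesis by (simp add: t)
      qed
      then have "(\<Sum>j\<in>F. t j x) = D * (\<Sum>j\<in>F. pole_coeff j n * eigenfun j x)" for x
        unfolding sum_distrib_left by (intro sum.cong refl)
      then have "(\<lambda>x. (\<Sum>j\<in>F. t j x) - S x) = (\<lambda>x. D * remainder n F x)"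
        by (simp add: S_def remainder_def distrib_left add.commute)
      then show "cmod D * nrm (remainder n F) = nrm (\<lambda>x. (\<Sum>j\<in>F. t j x) - S x)"
        by (simp add: norm_L2_cmult)
    qed
    ultimately show "((\<lambda>F. nrm (\<lambda>x. (\<Sum>j\<in>F. t j x) - S x)) \<longlongrightarrow> 0) (finite_subsets_at_top (UNIV - {0}))"
      by (simp add: tendsto_cong)
  qed
  \<comment> \<open>With this choice of \<open>S\<close> the identity holds at every real x, hence
    almost everywhere.\<close>
  moreover have "bernoulli_dunkl n \<alpha> (of_real x) = - ((- \<i>) ^ n) * of_real (dunkl_gamma n \<alpha>) / C * S x" for x
    using C0 by (simp add: bernoulli_dunkl_eq[OF \<alpha>] S_def D_def)
  ultimately show ?thesis
    unfolding t_def C_def by blast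
qed

end
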